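(* Let $(X,d_X,m_X)$ be a metric measure space with $\operatorname{supp}m_X=X$ satisfying the curvature-dimension condition $CD(k,N)$ for some admissible $k:X\to\mathbb R$ and $N\ge1$. Then the Hausdorff dimension of $(X,d_X)$ is $\le N$.
   Context: A function $k:X\to\mathbb R$ is admissible if it is lower semicontinuous and locally bounded from below. A metric measure space $(X,d_X,m_X)$ is a complete separable metric space $(X,d_X)$ with a Borel measure $m_X$ such that for every $x\in X$ there is $r>0$ with $m_X(B_r(x))\in(0,\infty)$; also $m_X(X)\ne 0$. A geodesic is a distance-minimizing curve $\gamma:[0,1]\to X$ of constant speed; $|\dot\gamma|$ denotes its speed, i.e. its length. $\mathcal G(X)$ is the set of geodesics with the sup-distance, and $e_t(\gamma)=\gamma(t)$. $\mathcal P_2(X)$ is the set of Borel probability measures with finite second moment, with the $L^2$-Wasserstein distance, and $\mathcal P_2(X,m_X)$ is the subset of $m_X$-absolutely continuous ones. A dynamical optimal coupling of $\mu_0,\mu_1$ is a probability measure $\Pi$ on $\mathcal G(X)$ such that $(e_0,e_1)_*\Pi$ is an optimal coupling (for the cost $d_X^2$) of $\mu_0,\mu_1$. Distortion coefficients. For $\theta>0$ and continuous $\kappa:[0,\theta]\to\mathbb R$ let $\mathfrak s_\kappa$ be the solution of $u''+\kappa u=0$, $u(0)=0$, $u'(0)=1$. For $t\in[0,1]$ put $\sigma^{(t)}_\kappa(\theta)=\mathfrak s_\kappa(t\theta)/\mathfrak s_\kappa(\theta)$ if $\mathfrak s_\kappa>0$ on $(0,\theta]$, and $\sigma^{(t)}_\kappa(\theta)=\infty$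 otherwise. For lower semicontinuous $\kappa:[0,\theta]\to\mathbb R$ put $\kappa_n(s)=\inf_{r\in[0,\theta]}\{\kappa(r)+n|s-r|\}$ and $\sigma^{(t)}_\kappa(\theta)=\lim_{n\to\infty}\sigma^{(t)}_{\kappa_n}(\theta)\in[0,\infty]$ (consistent for continuous $\kappa$). Put $\sigma_\kappa^{(t)}(0)=t$. For lower semicontinuous $k:X\to\mathbb R$ and a geodesic $\gamma$ with $\theta=|\dot\gamma|$ let $\bar\gamma:[0,\theta]\to X$ be its unit speed reparametrization, $k^+_\gamma=k_\gamma=k\circ\bar\gamma$ and $k^-_\gamma(s)=k_\gamma(\theta-s)$. For $N>0$ set $\sigma^{(t)}_{k^\pm_\gamma,N}(\theta)=\sigma^{(t)}_{k^\pm_\gamma/N}(\theta)$. For $N>1$ set $\tau^{(t)}_{k^\pm_\gamma,N}(\theta)=t^{1/N}\big[\sigma^{(t)}_{k^\pm_\gamma,N-1}(\theta)\big]^{(N-1)/N}$; for $N=1$ set $\tau^{(t)}_{k_\gamma^\pm,1}(\theta)=\theta\cdot\infty$ if $k_\gamma>0$ and $=t$ otherwise. Conventions: $r\cdot\infty=\infty$ for $r>0$, $0\cdot\infty=0$, $\infty^\alpha=\infty$ for $\alpha>0$. Condition $CD(k,N)$, $N\ge1$. For $\nu=\varrho m_X+\nu^s$ (Lebesgue decomposition) let $S_N(\nu)=-\int_X\varrho^{1-1/N}\,dm_X$. $(X,d_X,m_X)$ satisfies $CD(k,N)$ if for each pair $\nu_0=\varrho_0m_X,\nu_1=\varrho_1m_X\in\mathcal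 P_2(X,m_X)$ with bounded support there exist a dynamical optimal coupling $\Pi$ of $\nu_0,\nu_1$ and a geodesic $(\nu_t)_{t\in[0,1]}\subset\mathcal P_2(X,m_X)$ from $\nu_0$ to $\nu_1$ such that $$S_{N'}(\nu_t)\le-\int\Big[\tau^{(1-t)}_{k^-_\gamma,N'}(|\dot\gamma|)\varrho_0(\gamma(0))^{-1/N'}+\tau^{(t)}_{k^+_\gamma,N'}(|\dot\gamma|)\varrho_1(\gamma(1))^{-1/N'}\Big]d\Pi(\gamma)$$ for all $t\in[0,1]$ and all $N'\ge N$. *)

theory Defs
  imports "HOL-Probability.Probability"
begin

section \<open>Metric measure spaces\<close>

text \<open>The complete separable metric space is the carrier type, of class \<^class>\<open>polish_space\<close>.\<close>

definition metric_measure_space :: "'a::polish_space measure \<Rightarrow> bool" where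
  "metric_measure_space m \<longleftrightarrow>
     sets m = sets borel \<and>
     (\<forall>x. \<exists>r>0. 0 < emeasure m (ball x r) \<and> emeasure m (ball x r) < \<infinity>) \<and>
     emeasure m (space m) \<noteq> 0"

definition measure_support :: "'a::topological_space measure \<Rightarrow> 'a set" where
  "measure_support \<mu> = {x. \<forall>U. open U \<and> x \<in> U \<longrightarrow> 0 < emeasure \<mu> U}"

definition lower_semicontinuous :: "('a::topological_space \<Rightarrow> real) \<Rightarrow> bool" where
  "lower_semicontinuous k \<longleftrightarrow> (\<forall>x. \<forall>c<k x. \<forall>\<^sub>F y in nhds x. c < k y)"

definition locally_bounded_below :: "('a::topological_space \<Rightarrow> real) \<Rightarrow> bool" where
  "locally_bounded_below k \<longleftrightarrow> (\<forall>x. \<exists>U c. open U \<and> x \<in> U \<and> (\<forall>y\<in>U. c \<le> k y))"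

definition admissible :: "('a::topological_space \<Rightarrow> real) \<Rightarrow> bool" where
  "admissible k \<longleftrightarrow> lower_semicontinuous k \<and> locally_bounded_below k"

section \<open>Geodesics\<close>

definition const_speed_geodesic :: "('b \<Rightarrow> 'b \<Rightarrow> real) \<Rightarrow> (real \<Rightarrow> 'b) \<Rightarrow> bool" where
  "const_speed_geodesic d \<gamma> \<longleftrightarrow>
     (\<forall>s\<in>{0..1}. \<forall>t\<in>{0..1}. d (\<gamma> s) (\<gamma> t) = \<bar>s - t\<bar> * d (\<gamma> 0) (\<gamma> 1))"

text \<open>A geodesic on $[0,1]$ is represented by its extension to the real line that is constant on
  either side of $[0,1]$. The distance of the type of bounded continuous functions is then the
  sup-distance over $[0,1]$.\<close>

definition geodesics :: "(real \<Rightarrow>\<^sub>C 'a::metric_space) set" where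
  "geodesics = {\<gamma>. const_speed_geodesic dist (apply_bcontfun \<gamma>) \<and>
     (\<forall>t\<le>0. apply_bcontfun \<gamma> t = apply_bcontfun \<gamma> 0) \<and>
     (\<forall>t\<ge>1. apply_bcontfun \<gamma> t = apply_bcontfun \<gamma> 1)}"

definition speed :: "(real \<Rightarrow>\<^sub>C 'a::metric_space) \<Rightarrow> real" where
  "speed \<gamma> = dist (apply_bcontfun \<gamma> 0) (apply_bcontfun \<gamma> 1)"

text \<open>If the speed is \<open>0\<close>, division by zero gives \<open>\<gamma> 0\<close>, the only value needed.\<close>

definition unit_speed_param :: "(real \<Rightarrow>\<^sub>C 'a::metric_space) \<Rightarrow> real \<Rightarrow> 'a" where
  "unit_speed_param \<gamma> s = apply_bcontfun \<gamma> (s / speed \<gamma>)"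

section \<open>Wasserstein space\<close>

definition P2 :: "'a::metric_space measure set" where
  "P2 = {\<mu>. sets \<mu> = sets borel \<and> prob_space \<mu> \<and>
     (\<exists>x\<^sub>0. (\<integral>\<^sup>+x. ennreal ((dist x\<^sub>0 x)\<^sup>2) \<partial>\<mu>) < \<infinity>)}"

definition P2_ac :: "'a::metric_space measure \<Rightarrow> 'a measure set" where
  "P2_ac m = {\<mu> \<in> P2. absolutely_continuous m \<mu>}"

definition couplings ::
  "'a::metric_space measure \<Rightarrow> 'a measure \<Rightarrow> ('a \<times> 'a) measure set" where
  "couplings \<mu> \<nu> = {\<pi>. sets \<pi> = sets borel \<and> prob_space \<pi> \<and>
     distr \<pi> borel fst = \<mu> \<and> distr \<pi> borel snd = \<nu>}"

definition transport_cost :: "('a::metric_space \<times> 'a) measure \<Rightarrow> ennreal" where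
  "transport_cost \<pi> = (\<integral>\<^sup>+z. ennreal ((dist (fst z) (snd z))\<^sup>2) \<partial>\<pi>)"

definition W2 :: "'a::metric_space measure \<Rightarrow> 'a measure \<Rightarrow> real" where
  "W2 \<mu> \<nu> = sqrt (enn2real (INF \<pi>\<in>couplings \<mu> \<nu>. transport_cost \<pi>))"

definition optimal_coupling ::
  "'a::metric_space measure \<Rightarrow> 'a measure \<Rightarrow> ('a \<times> 'a) measure \<Rightarrow> bool" where
  "optimal_coupling \<mu> \<nu> \<pi> \<longleftrightarrow> \<pi> \<in> couplings \<mu> \<nu> \<and>
     (\<forall>\<pi>'\<in>couplings \<mu> \<nu>. transport_cost \<pi> \<le> transport_cost \<pi>')"

definition dynamical_optimal_coupling ::
  "'a::metric_space measure \<Rightarrow> 'a measure \<Rightarrow> (real \<Rightarrow>\<^sub>C 'a) measure \<Rightarrow> bool" where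
  "dynamical_optimal_coupling \<mu> \<nu> Q \<longleftrightarrow>
     sets Q = sets (restrict_space borel geodesics) \<and> prob_space Q \<and>
     optimal_coupling \<mu> \<nu> (distr Q borel (\<lambda>\<gamma>. (apply_bcontfun \<gamma> 0, apply_bcontfun \<gamma> 1)))"

section \<open>Distortion coefficients\<close>

text \<open>The solution is unique on \<open>{0..\<theta>}\<close>; its values elsewhere are arbitrary and never used.\<close>

definition gen_sin :: "(real \<Rightarrow> real) \<Rightarrow> real \<Rightarrow> real \<Rightarrow> real" where
  "gen_sin \<kappa> \<theta> = (SOME u. \<exists>u'. u 0 = 0 \<and> u' 0 = 1 \<and>
     (\<forall>s\<in>{0..\<theta>}. (u has_real_derivative u' s) (at s within {0..\<theta>}) \<and>
        (u' has_real_derivative - (\<kappa> s * u s)) (at s within {0..\<theta>})))"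

definition sigma_cont :: "(real \<Rightarrow> real) \<Rightarrow> real \<Rightarrow> real \<Rightarrow> ennreal" where
  "sigma_cont \<kappa> t \<theta> =
     (if \<forall>s\<in>{0<..\<theta>}. 0 < gen_sin \<kappa> \<theta> s
      then ennreal (gen_sin \<kappa> \<theta> (t * \<theta>) / gen_sin \<kappa> \<theta> \<theta>) else \<infinity>)"

definition lipschitz_approx :: "(real \<Rightarrow> real) \<Rightarrow> real \<Rightarrow> nat \<Rightarrow> real \<Rightarrow> real" where
  "lipschitz_approx \<kappa> \<theta> n s = (INF r\<in>{0..\<theta>}. \<kappa> r + real n * \<bar>s - r\<bar>)"

definition sigma :: "(real \<Rightarrow> real) \<Rightarrow> real \<Rightarrow> real \<Rightarrow> ennreal" where
  "sigma \<kappa> t \<theta> =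
     (if \<theta> = 0 then ennreal t
      else lim (\<lambda>n. sigma_cont (lipschitz_approx \<kappa> \<theta> n) t \<theta>))"

text \<open>Powers with values in $[0,\infty]$, with $\infty^\alpha = \infty$ for $\alpha > 0$. Since
  \<open>0 powr a = 0\<close> for every \<open>a\<close>, in particular $0^0 = 0$, so that the integrand of the entropy with
  exponent $1 - 1/N = 0$ is the indicator of $\{\varrho > 0\}$. The values $0^{\alpha}$ for negative
  exponents and $\infty^\alpha$ for $\alpha \le 0$ only occur on null sets.\<close>

definition epowr :: "ennreal \<Rightarrow> real \<Rightarrow> ennreal" where
  "epowr x a = (if x = \<infinity> \<and> 0 < a then \<infinity> else ennreal (enn2real x powr a))"

definition tau :: "(real \<Rightarrow> real) \<Rightarrow> real \<Rightarrow> real \<Rightarrow> real \<Rightarrow> ennreal" where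
  "tau \<kappa> N t \<theta> =
     (if N = 1 then (if \<forall>s\<in>{0..\<theta>}. 0 < \<kappa> s then ennreal \<theta> * \<infinity> else ennreal t)
      else ennreal (t powr (1 / N)) * epowr (sigma (\<lambda>s. \<kappa> s / (N - 1)) t \<theta>) ((N - 1) / N))"

definition k_plus :: "('a::metric_space \<Rightarrow> real) \<Rightarrow> (real \<Rightarrow>\<^sub>C 'a) \<Rightarrow> real \<Rightarrow> real" where
  "k_plus k \<gamma> s = k (unit_speed_param \<gamma> s)"

definition k_minus :: "('a::metric_space \<Rightarrow> real) \<Rightarrow> (real \<Rightarrow>\<^sub>C 'a) \<Rightarrow> real \<Rightarrow> real" where
  "k_minus k \<gamma> s = k_plus k \<gamma> (speed \<gamma> - s)"

section \<open>Entropy and the curvature-dimension condition\<close>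

definition lebesgue_decomposition ::
  "'a measure \<Rightarrow> 'a measure \<Rightarrow> ('a \<Rightarrow> ennreal) \<Rightarrow> 'a measure \<Rightarrow> bool" where
  "lebesgue_decomposition m \<nu> \<rho> \<nu>s \<longleftrightarrow>
     \<rho> \<in> borel_measurable m \<and> sets \<nu>s = sets m \<and>
     (\<exists>S\<in>null_sets m. emeasure \<nu>s (space m - S) = 0) \<and>
     (\<forall>A\<in>sets m. emeasure \<nu> A = emeasure (density m \<rho>) A + emeasure \<nu>s A)"

definition ac_density :: "'a measure \<Rightarrow> 'a measure \<Rightarrow> 'a \<Rightarrow> ennreal" where
  "ac_density m \<nu> = (SOME \<rho>. \<exists>\<nu>s. lebesgue_decomposition m \<nu> \<rho> \<nu>s)"

definition entropy_S :: "'a measure \<Rightarrow> real \<Rightarrow> 'a measure \<Rightarrow> ereal" where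
  "entropy_S m N \<nu> = - enn2ereal (\<integral>\<^sup>+x. epowr (ac_density m \<nu> x) (1 - 1 / N) \<partial>m)"

definition CD :: "'a::polish_space measure \<Rightarrow> ('a \<Rightarrow> real) \<Rightarrow> real \<Rightarrow> bool" where
  "CD m k N \<longleftrightarrow>
     (\<forall>\<nu>\<^sub>0\<in>P2_ac m. \<forall>\<nu>\<^sub>1\<in>P2_ac m.
        bounded (measure_support \<nu>\<^sub>0) \<and> bounded (measure_support \<nu>\<^sub>1) \<longrightarrow>
        (\<exists>Q \<nu>. dynamical_optimal_coupling \<nu>\<^sub>0 \<nu>\<^sub>1 Q \<and>
           (\<forall>t\<in>{0..1}. \<nu> t \<in> P2_ac m) \<and> const_speed_geodesic W2 \<nu> \<and> \<nu> 0 = \<nu>\<^sub>0 \<and> \<nu> 1 = \<nu>\<^sub>1 \<and>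
           (\<forall>t\<in>{0..1}. \<forall>N'\<ge>N.
              entropy_S m N' (\<nu> t) \<le>
                - enn2ereal (\<integral>\<^sup>+\<gamma>.
                    (tau (k_minus k \<gamma>) N' (1 - t) (speed \<gamma>) *
                       epowr (RN_deriv m \<nu>\<^sub>0 (apply_bcontfun \<gamma> 0)) (- 1 / N')
                     + tau (k_plus k \<gamma>) N' t (speed \<gamma>) *
                       epowr (RN_deriv m \<nu>\<^sub>1 (apply_bcontfun \<gamma> 1)) (- 1 / N')) \<partial>Q))))"

section \<open>Hausdorff dimension\<close>

text \<open>Covering sets are required to be bounded because \<^const>\<open>diameter\<close> is unspecified on unbounded
  sets. For \<open>s = 0\<close> a nonempty set has weight \<open>1\<close>.\<close>

definition hausdorff_weight :: "real \<Rightarrow> 'a::metric_space set \<Rightarrow> ennreal" where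
  "hausdorff_weight s U =
     (if U = {} then 0 else if s = 0 then 1 else ennreal (diameter U powr s))"

definition hausdorff_pre :: "real \<Rightarrow> real \<Rightarrow> 'a::metric_space set \<Rightarrow> ennreal" where
  "hausdorff_pre s \<delta> A =
     (INF U\<in>{U :: nat \<Rightarrow> 'a set. A \<subseteq> (\<Union>i. U i) \<and> (\<forall>i. bounded (U i) \<and> diameter (U i) \<le> \<delta>)}.
        \<Sum>i. hausdorff_weight s (U i))"

definition hausdorff_measure :: "real \<Rightarrow> 'a::metric_space set \<Rightarrow> ennreal" where
  "hausdorff_measure s A = (SUP \<delta>\<in>{0<..}. hausdorff_pre s \<delta> A)"

definition hausdorff_dim :: "'a::metric_space set \<Rightarrow> ereal" where
  "hausdorff_dim A = Inf {ereal s | s. 0 \<le> s \<and> hausdorff_measure s A = 0}"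

end

theory Submission
  imports Defs
begin

text \<open>
  The dimension bound is a statement about how slowly the measure of small balls may decay. If
  around every point there are \<open>R\<close> and \<open>c > 0\<close> with \<open>m (cball x r) \<ge> c * r powr p\<close> for all \<open>x\<close>
  in a fixed ball of finite measure and all small \<open>r\<close>, then at most about \<open>r powr (- p)\<close> disjoint
  balls of radius \<open>r\<close> fit into it, so a maximal separated set gives a cover by that many balls of
  radius \<open>2 * r\<close>. Hence the \<open>s\<close>-dimensional measure vanishes for every \<open>s > p\<close>
  (\<open>hausdorff_pre_null_of_volume_growth\<close>), and by separability countably many such balls exhaust
  the space. It therefore suffices to prove the growth bound for each exponent \<open>p = N' > N\<close>. Then
  \<open>N' > 1\<close>, so that \<^const>\<open>tau\<close> is governed by the solutions of a Jacobi equation and not by the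
  separate formula for the exponent \<open>1\<close>.

  The growth bound (\<open>CD_volume_growth\<close>) is a Brunn--Minkowski inequality. Transport the uniform
  measure of the tiny ball \<open>ball x (t * R)\<close> to the uniform measure of the fixed ball
  \<open>ball x0 R\<close>. The measure \<open>\<nu> t\<close> at time \<open>t\<close> has moved by at most a multiple of \<open>t * R\<close>, so it
  lives on \<open>cball x (5 * t * R)\<close>, and its entropy controls the measure \<open>b\<close> of that ball from below:
  the entropy integral is at most \<open>2 * b powr (1 / N')\<close> (\<open>entropy_integral_bound\<close>). The
  curvature-dimension inequality bounds the same integral from below by the distortion coefficient
  times \<open>a powr (1 / N')\<close>, where \<open>a\<close> is the measure of \<open>ball x0 R\<close>. For \<open>R\<close> small this
  coefficient is at least \<open>t / 2\<close>, whence \<open>b \<ge> (t / 4) powr N' * a\<close>.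

  Two ingredients need work. The distortion coefficients are defined through solutions of
  \<open>u'' + \<kappa> u = 0\<close>, so one needs existence of solutions and Sturm comparison: comparison makes the
  coefficients monotone in \<open>\<kappa>\<close>, hence the limit over the Lipschitz approximations of \<open>\<kappa>\<close> exists,
  and comparison with an explicit cubic polynomial gives the bound \<open>t / 2\<close> (\<open>tau_lower_bound\<close>).
  Secondly, the curve \<open>\<nu>\<close> is only known to be a geodesic for the Wasserstein distance; it is not
  given as the curve of marginals of the dynamical coupling. That \<open>\<nu> t\<close> is concentrated near \<open>x\<close>
  is therefore derived from the distances alone
  (\<open>wasserstein_intermediate_concentrated\<close>): gluing almost optimal couplings of \<open>\<nu> 0, \<nu> t\<close> and of
  \<open>\<nu> t, \<nu> 1\<close> almost produces an optimal coupling of \<open>\<nu> 0, \<nu> 1\<close>, and near equality in the triangle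
  inequality forces almost every intermediate point to divide its segment in the ratio \<open>t : 1 - t\<close>.
\<close>

section \<open>Jacobi equations and Sturm comparison\<close>

text \<open>The derivative \<open>u'\<close> is carried along as a second function, so that the equation is a first order
  system on the closed interval, with one-sided derivatives at its ends. For fixed \<open>u\<close>, the existence
  of such a \<open>u'\<close> is the condition by which \<^const>\<open>gen_sin\<close> selects its value.\<close>

definition jacobi_solution ::
  "(real \<Rightarrow> real) \<Rightarrow> real \<Rightarrow> (real \<Rightarrow> real) \<Rightarrow> (real \<Rightarrow> real) \<Rightarrow> bool" where
  "jacobi_solution \<kappa> \<theta> u u' \<longleftrightarrow> u 0 = 0 \<and> u' 0 = 1 \<and>
     (\<forall>s\<in>{0..\<theta>}. (u has_real_derivative u' s) (at s within {0..\<theta>}) \<and>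
        (u' has_real_derivative - (\<kappa> s * u s)) (at s within {0..\<theta>}))"

text \<open>The integral form \<open>u s = s - \<integral>\<^sub>0\<^sup>s (s - r) * \<kappa> r * u r dr\<close> of the initial value problem has a solution
  because the right-hand side is a contraction for a sufficiently strong exponential weight: for
  \<open>w s = exp (- a * s) * u s\<close> the integral gains a factor \<open>1 / a\<close> in the supremum norm. The kernel
  \<open>s - r\<close> is split so that \<open>s\<close> occurs only in front of the integrals and in their limits, which can
  then be differentiated.\<close>

lemma volterra_fixed_point:
  fixes \<kappa> :: "real \<Rightarrow> real"
  assumes \<theta>: "0 \<le> \<theta>" and \<kappa>: "continuous_on {0..\<theta>} \<kappa>"
  obtains u where "continuous_on {0..\<theta>} u"
    and "\<And>s. s \<in> {0..\<theta>} \<Longrightarrow>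
      u s = s - s * integral {0..s} (\<lambda>r. \<kappa> r * u r) + integral {0..s} (\<lambda>r. r * \<kappa> r * u r)"
proof -
  obtain L0 where L0: "\<And>s. s \<in> {0..\<theta>} \<Longrightarrow> \<bar>\<kappa> s\<bar> \<le> L0"
    using compact_imp_bounded[OF compact_continuous_image[OF \<kappa> compact_Icc]]
    unfolding bounded_iff by (force simp: image_def)
  define L where "L = max L0 0"
  have L: "\<bar>\<kappa> s\<bar> \<le> L" if "s \<in> {0..\<theta>}" for s using L0[OF that] by (simp add: L_def)
  have L_nonneg: "0 \<le> L" by (simp add: L_def)
  \<comment> \<open>The weight is chosen such that \<open>\<theta> * L / a \<le> 1 / 2\<close>.\<close>
  define a where "a = 2 * L * \<theta> + 1"
  have a: "0 < a" using L_nonneg \<theta> by (simp add: a_def add_nonneg_pos)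
  \<comment> \<open>The retraction onto \<open>{0..\<theta>}\<close> makes functions on the interval bounded continuous functions on the
    line, which form a complete space.\<close>
  define p where "p x = max 0 (min \<theta> x)" for x :: real
  have p_mem: "p x \<in> {0..\<theta>}" for x using \<theta> by (auto simp: p_def)
  have p_id: "p x = x" if "x \<in> {0..\<theta>}" for x using that by (auto simp: p_def)
  define G where "G w s = integral {0..s} (\<lambda>r. \<kappa> r * (exp (a * r) * w r))" for w :: "real \<Rightarrow> real" and s
  define H where "H w s = integral {0..s} (\<lambda>r. r * \<kappa> r * (exp (a * r) * w r))" for w :: "real \<Rightarrow> real" and s
  define F where "F w s = exp (- a * s) * (s - s * G w s + H w s)" for w s
  have cG: "continuous_on {0..\<theta>} (\<lambda>r. \<kappa> r * (exp (a * r) * w r))"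
    and cH: "continuous_on {0..\<theta>} (\<lambda>r. r * \<kappa> r * (exp (a * r) * w r))"
    if "continuous_on {0..\<theta>} w" for w :: "real \<Rightarrow> real"
    by (intro continuous_intros \<kappa> that)+
  have cF: "continuous_on {0..\<theta>} (F w)" if "continuous_on {0..\<theta>} w" for w
    unfolding F_def G_def H_def
    by (intro continuous_intros indefinite_integral_continuous_1 integrable_continuous_real cG cH that)
  have F_bcont: "(\<lambda>x. F w (p x)) \<in> bcontfun" if "continuous_on {0..\<theta>} w" for w
    unfolding bcontfun_def
  proof (intro CollectI conjI)
    show "continuous_on UNIV (\<lambda>x. F w (p x))"
      by (rule continuous_on_compose2[OF cF[OF that]])
        (use p_mem in \<open>auto simp: p_def intro!: continuous_intros\<close>)
    have "bounded (F w ` {0..\<theta>})"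
      by (intro compact_imp_bounded compact_continuous_image cF that compact_Icc)
    then show "bounded (range (\<lambda>x. F w (p x)))"
      by (rule bounded_subset) (use p_mem in auto)
  qed
  define T where "T w = Bcontfun (\<lambda>x. F (apply_bcontfun w) (p x))" for w :: "real \<Rightarrow>\<^sub>C real"
  have T: "apply_bcontfun (T w) x = F (apply_bcontfun w) (p x)" for w x
    unfolding T_def by (subst Bcontfun_inverse) (auto intro: F_bcont)
  have contr: "dist (T w) (T v) \<le> 1/2 * dist w v" for w v
  proof (rule dist_bound)
    fix x
    define q where "q = p x"
    have q: "0 \<le> q" "q \<le> \<theta>" using p_mem[of x] by (auto simp: q_def)
    let ?w = "apply_bcontfun w" and ?v = "apply_bcontfun v"
    define D where "D = dist w v"
    have sub: "{0..q} \<subseteq> {0..\<theta>}" using q by auto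
    have iG: "(\<lambda>r. \<kappa> r * (exp (a * r) * apply_bcontfun w r)) integrable_on {0..q}"
      and iH: "(\<lambda>r. r * \<kappa> r * (exp (a * r) * apply_bcontfun w r)) integrable_on {0..q}" for w
      by (intro integrable_continuous_real continuous_on_subset[OF cG sub]
          continuous_on_subset[OF cH sub]; simp)+
    have eq: "(q * G ?w q - H ?w q) - (q * G ?v q - H ?v q) =
        integral {0..q} (\<lambda>r. (q - r) * \<kappa> r * exp (a * r) * (?w r - ?v r))"
    proof -
      have "q * G w q - H w q = integral {0..q} (\<lambda>r. (q - r) * \<kappa> r * exp (a * r) * apply_bcontfun w r)" for w :: "real \<Rightarrow>\<^sub>C real"
      proof -
        have "q * G w q - H w q = integral {0..q} (\<lambda>r. q * (\<kappa> r * (exp (a * r) * apply_bcontfun w r)) -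
            r * \<kappa> r * (exp (a * r) * apply_bcontfun w r))"
          unfolding G_def H_def
          by (subst integral_diff) (auto intro!: integrable_on_mult_right iG iH)
        then show ?thesis by (simp add: algebra_simps)
      qed
      moreover have "(\<lambda>r. (q - r) * \<kappa> r * exp (a * r) * apply_bcontfun w r) integrable_on {0..q}" for w
        by (intro integrable_continuous_real continuous_intros continuous_on_subset[OF \<kappa> sub]) auto
      ultimately show ?thesis
        by (simp add: integral_diff[symmetric] right_diff_distrib)
    qed
    have hi: "((\<lambda>r. \<theta> * L * D * exp (a * r)) has_integral
        (\<theta> * L * D / a * exp (a * q) - \<theta> * L * D / a * exp (a * 0))) {0..q}"
      by (rule fundamental_theorem_of_calculus)
        (use q a in \<open>auto intro!: derivative_eq_intros
          simp: has_real_derivative_iff_has_vector_derivative[symmetric]\<close>)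
    have "norm (integral {0..q} (\<lambda>r. (q - r) * \<kappa> r * exp (a * r) * (?w r - ?v r)))
        \<le> integral {0..q} (\<lambda>r. \<theta> * L * D * exp (a * r))"
    proof (rule integral_norm_bound_integral)
      show "(\<lambda>r. (q - r) * \<kappa> r * exp (a * r) * (?w r - ?v r)) integrable_on {0..q}"
        by (intro integrable_continuous_real continuous_intros continuous_on_subset[OF \<kappa> sub]) auto
      show "(\<lambda>r. \<theta> * L * D * exp (a * r)) integrable_on {0..q}" using hi by blast
      fix r assume r: "r \<in> {0..q}"
      have "\<bar>?w r - ?v r\<bar> \<le> D" unfolding D_def using dist_bounded[of w r v] by (simp add: dist_real_def)
      moreover have "\<bar>q - r\<bar> \<le> \<theta>" "\<bar>\<kappa> r\<bar> \<le> L" using r q L[of r] by auto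
      ultimately have "\<bar>q - r\<bar> * \<bar>\<kappa> r\<bar> * exp (a * r) * \<bar>?w r - ?v r\<bar> \<le> \<theta> * L * exp (a * r) * D"
        using \<theta> L_nonneg by (intro mult_mono) auto
      then show "norm ((q - r) * \<kappa> r * exp (a * r) * (?w r - ?v r)) \<le> \<theta> * L * D * exp (a * r)"
        by (simp add: abs_mult mult_ac)
    qed
    also have "\<dots> \<le> \<theta> * L * D / a * exp (a * q)"
      using integral_unique[OF hi] \<theta> L_nonneg a by (simp add: D_def)
    also have "\<dots> \<le> 1/2 * D * exp (a * q)"
    proof -
      have "\<theta> * L / a \<le> 1/2" using a by (simp add: field_simps) (simp add: a_def)
      then have "\<theta> * L / a * (D * exp (a * q)) \<le> 1/2 * (D * exp (a * q))"
        by (rule mult_right_mono) (simp add: D_def)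
      then show ?thesis by (simp add: mult_ac)
    qed
    finally have b: "\<bar>(q * G ?w q - H ?w q) - (q * G ?v q - H ?v q)\<bar> \<le> 1/2 * D * exp (a * q)"
      by (simp add: eq)
    have "dist (T w x) (T v x) = \<bar>exp (- a * q) * ((q * G ?w q - H ?w q) - (q * G ?v q - H ?v q))\<bar>"
      by (simp add: T F_def q_def[symmetric] dist_real_def abs_minus_commute algebra_simps)
    also have "\<dots> \<le> exp (- a * q) * (1/2 * D * exp (a * q))"
      unfolding abs_mult using b by (intro mult_mono) auto
    also have "\<dots> = 1/2 * dist w v" by (simp add: D_def exp_minus field_simps)
    finally show "dist (T w x) (T v x) \<le> 1/2 * dist w v" .
  qed
  obtain w where w: "T w = w"
    using banach_fix_type[of "1/2" T] contr by auto
  define u where "u s = exp (a * s) * apply_bcontfun w s" for s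
  show thesis
  proof
    show "continuous_on {0..\<theta>} u" unfolding u_def by (intro continuous_intros) auto
    fix s assume s: "s \<in> {0..\<theta>}"
    have "apply_bcontfun w s = F (apply_bcontfun w) s" using T[of w s] by (simp add: w p_id[OF s])
    then have "u s = s - s * G w s + H w s"
      by (simp add: u_def F_def exp_minus field_simps)
    then show "u s = s - s * integral {0..s} (\<lambda>r. \<kappa> r * u r) + integral {0..s} (\<lambda>r. r * \<kappa> r * u r)"
      by (simp add: G_def H_def u_def)
  qed
qed

text \<open>In the first derivative of the Volterra equation the two boundary terms \<open>s * \<kappa> s * u s\<close> cancel;
  what remains is \<open>1\<close> minus the integral of \<open>\<kappa> * u\<close>, whose derivative is the right-hand side of the
  Jacobi equation.\<close>

lemma jacobi_solution_exists:
  assumes \<theta>: "0 \<le> \<theta>" and \<kappa>: "continuous_on {0..\<theta>} \<kappa>"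
  shows "\<exists>u u'. jacobi_solution \<kappa> \<theta> u u'"
proof -
  obtain u where cu: "continuous_on {0..\<theta>} u" and u: "\<And>s. s \<in> {0..\<theta>} \<Longrightarrow>
      u s = s - s * integral {0..s} (\<lambda>r. \<kappa> r * u r) + integral {0..s} (\<lambda>r. r * \<kappa> r * u r)"
    using volterra_fixed_point[OF assms] by blast
  define u' where "u' s = 1 - integral {0..s} (\<lambda>r. \<kappa> r * u r)" for s
  have dI: "((\<lambda>s. integral {0..s} (\<lambda>r. \<kappa> r * u r)) has_real_derivative \<kappa> s * u s) (at s within {0..\<theta>})"
    and dJ: "((\<lambda>s. integral {0..s} (\<lambda>r. r * \<kappa> r * u r)) has_real_derivative s * \<kappa> s * u s) (at s within {0..\<theta>})"
    if "s \<in> {0..\<theta>}" for s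
    by (intro integral_has_real_derivative[OF _ that] continuous_intros \<kappa> cu)+
  have "jacobi_solution \<kappa> \<theta> u u'"
    unfolding jacobi_solution_def
  proof (intro conjI ballI)
    show "u 0 = 0" using u[of 0] \<theta> by simp
    show "u' 0 = 1" by (simp add: u'_def)
    fix s assume s: "s \<in> {0..\<theta>}"
    show "(u' has_real_derivative - (\<kappa> s * u s)) (at s within {0..\<theta>})"
      unfolding u'_def by (rule derivative_eq_intros dI[OF s] refl | simp)+
    have "((\<lambda>s. s - s * integral {0..s} (\<lambda>r. \<kappa> r * u r) + integral {0..s} (\<lambda>r. r * \<kappa> r * u r))
        has_real_derivative u' s) (at s within {0..\<theta>})"
      by (rule derivative_eq_intros dI[OF s] dJ[OF s] refl | simp add: u'_def)+
    then show "(u has_real_derivative u' s) (at s within {0..\<theta>})"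
      by (rule has_field_derivative_transform_within[where d = 1]) (use s u in auto)
  qed
  then show ?thesis by blast
qed

text \<open>Existence of a solution turns the choice in the definition of \<^const>\<open>gen_sin\<close> into an actual
  solution.\<close>

lemma gen_sin_jacobi:
  assumes "0 \<le> \<theta>" "continuous_on {0..\<theta>} \<kappa>"
  shows "\<exists>u'. jacobi_solution \<kappa> \<theta> (gen_sin \<kappa> \<theta>) u'"
  using someI_ex[OF jacobi_solution_exists[OF assms]]
  unfolding gen_sin_def jacobi_solution_def by blast

text \<open>The Wronskian \<open>u' * v - u * v'\<close> vanishes at \<open>0\<close> and has derivative \<open>f * v - g * u \<ge> 0\<close>, so it is
  nonnegative, and it is the numerator of the derivative of \<open>u / v\<close>. The second derivatives \<open>f\<close> and
  \<open>g\<close> are kept general because the comparison is also made with a function that satisfies only a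
  differential inequality.\<close>

lemma sturm_ratio_mono:
  fixes u v u' v' f g :: "real \<Rightarrow> real"
  assumes du: "\<And>s. s \<in> {0..z} \<Longrightarrow> (u has_real_derivative u' s) (at s within {0..z})"
    and du': "\<And>s. s \<in> {0..z} \<Longrightarrow> (u' has_real_derivative f s) (at s within {0..z})"
    and dv: "\<And>s. s \<in> {0..z} \<Longrightarrow> (v has_real_derivative v' s) (at s within {0..z})"
    and dv': "\<And>s. s \<in> {0..z} \<Longrightarrow> (v' has_real_derivative g s) (at s within {0..z})"
    and zero: "u 0 = 0" "v 0 = 0"
    and le: "\<And>s. s \<in> {0<..<z} \<Longrightarrow> g s * u s \<le> f s * v s"
    and pos: "\<And>s. s \<in> {0<..z} \<Longrightarrow> 0 < v s"
    and ab: "0 < a" "a \<le> b" "b \<le> z"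
  shows "u a / v a \<le> u b / v b"
proof -
  define W where "W s = u' s * v s - u s * v' s" for s
  have D: "(u has_real_derivative u' s) (at s)" "(v has_real_derivative v' s) (at s)"
    "(u' has_real_derivative f s) (at s)" "(v' has_real_derivative g s) (at s)"
    if "0 < s" "s < z" for s
    using du[of s] dv[of s] du'[of s] dv'[of s] that by (simp_all add: at_within_Icc_at)
  have cont: "continuous_on {0..z} u" "continuous_on {0..z} v"
     "continuous_on {0..z} u'" "continuous_on {0..z} v'"
    using du dv du' dv' by (meson DERIV_continuous_on)+
  have W: "0 \<le> W s" if s: "0 \<le> s" "s \<le> z" for s
  proof -
    have "W 0 \<le> W s"
    proof (rule DERIV_nonneg_imp_increasing_open[OF s(1)])
      fix x assume x: "0 < x" "x < s"
      then have "0 < x" "x < z" using s by auto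
      note [derivative_intros] = D[OF this]
      have "(W has_real_derivative f x * v x - g x * u x) (at x)"
        unfolding W_def by (rule derivative_eq_intros refl | simp)+
      moreover have "0 \<le> f x * v x - g x * u x" using le[of x] x s by auto
      ultimately show "\<exists>y. (W has_real_derivative y) (at x) \<and> 0 \<le> y" by blast
    next
      have "continuous_on {0..z} W" unfolding W_def by (intro continuous_intros cont)
      then show "continuous_on {0..s} W" by (rule continuous_on_subset) (use s in auto)
    qed
    then show ?thesis by (simp add: W_def zero)
  qed
  show ?thesis
  proof (rule DERIV_nonneg_imp_increasing_open[OF ab(2)])
    fix x assume x: "a < x" "x < b"
    then have x': "0 < x" "x < z" using ab by auto
    note [derivative_intros] = D[OF this]
    have vx: "0 < v x" using pos[of x] x' by auto
    have "((\<lambda>s. u s / v s) has_real_derivative W x / (v x * v x)) (at x)"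
      unfolding W_def using vx by (auto intro!: derivative_eq_intros)
    moreover have "0 \<le> W x / (v x * v x)" using W[of x] x' vx by simp
    ultimately show "\<exists>y. ((\<lambda>s. u s / v s) has_real_derivative y) (at x) \<and> 0 \<le> y" by blast
  next
    have "continuous_on {a..b} u" "continuous_on {a..b} v"
      using cont ab by (auto elim!: continuous_on_subset)
    then show "continuous_on {a..b} (\<lambda>s. u s / v s)"
      using pos ab by (intro continuous_intros) (auto simp: less_imp_neq[symmetric])
  qed
qed

lemma jacobi_solution_subinterval:
  "jacobi_solution \<kappa> \<theta> u u' \<Longrightarrow> z \<le> \<theta> \<Longrightarrow> jacobi_solution \<kappa> z u u'"
  unfolding jacobi_solution_def by (auto intro!: has_field_derivative_subset[where t="{0..z}" and s="{0..\<theta>}"])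

lemma jacobi_solution_pos_near_zero:
  assumes u: "jacobi_solution \<kappa> \<theta> u u'" and \<theta>: "0 < \<theta>"
  obtains d where "0 < d" "d < \<theta>" "\<And>s. 0 < s \<Longrightarrow> s \<le> d \<Longrightarrow> 0 < u s"
proof -
  have "(u has_real_derivative 1) (at 0 within {0..\<theta>})" "u 0 = 0"
    using u \<theta> unfolding jacobi_solution_def by force+
  then obtain d where d: "d > 0" "\<forall>h>0. 0 + h \<in> {0..\<theta>} \<longrightarrow> h < d \<longrightarrow> u 0 < u (0 + h)"
    using has_real_derivative_pos_inc_right[of u 1 0 "{0..\<theta>}"] by auto
  show thesis
    by (rule that[of "min d \<theta> / 2"]) (use d \<theta> \<open>u 0 = 0\<close> in auto)
qed

lemma jacobi_ratio_mono:
  assumes u: "jacobi_solution \<kappa>1 z u u'" and v: "jacobi_solution \<kappa>2 z v v'"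
    and le: "\<And>s. s \<in> {0..z} \<Longrightarrow> \<kappa>1 s \<le> \<kappa>2 s"
    and u_pos: "\<And>s. s \<in> {0<..<z} \<Longrightarrow> 0 \<le> u s" and v_pos: "\<And>s. s \<in> {0<..z} \<Longrightarrow> 0 < v s"
    and ab: "0 < a" "a \<le> b" "b \<le> z"
  shows "u a / v a \<le> u b / v b"
proof (rule sturm_ratio_mono[where u = u and v = v and z = z])
  fix s assume s: "s \<in> {0<..<z}"
  have "0 \<le> u s * v s" using u_pos[OF s] v_pos[of s] s by simp
  then have "\<kappa>1 s * (u s * v s) \<le> \<kappa>2 s * (u s * v s)" using le[of s] s by (intro mult_right_mono) auto
  then show "- (\<kappa>2 s * v s) * u s \<le> - (\<kappa>1 s * u s) * v s" by (simp add: mult_ac)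
qed (use u v v_pos ab in \<open>auto simp: jacobi_solution_def\<close>)

text \<open>At a first zero of \<open>u\<close> the ratio \<open>u / v\<close> would have fallen from a positive value near \<open>0\<close> to a
  nonpositive one, against its monotonicity on the interval up to that zero.\<close>

lemma jacobi_positivity:
  assumes u: "jacobi_solution \<kappa>1 \<theta> u u'" and v: "jacobi_solution \<kappa>2 \<theta> v v'"
    and le: "\<And>s. s \<in> {0..\<theta>} \<Longrightarrow> \<kappa>1 s \<le> \<kappa>2 s"
    and v_pos: "\<And>s. s \<in> {0<..\<theta>} \<Longrightarrow> 0 < v s"
    and s: "s \<in> {0<..\<theta>}"
  shows "0 < u s"
proof (rule ccontr)
  assume neg: "\<not> 0 < u s"
  obtain d where d: "0 < d" "d < \<theta>" "\<And>s. 0 < s \<Longrightarrow> s \<le> d \<Longrightarrow> 0 < u s"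
    using jacobi_solution_pos_near_zero[OF u] s by auto
  have "continuous_on {0..\<theta>} u"
    using u unfolding jacobi_solution_def by (meson DERIV_continuous_on)
  then have c: "continuous_on {d..\<theta>} u" by (rule continuous_on_subset) (use d in auto)
  define S where "S = {x \<in> {d..\<theta>}. u x \<le> 0}"
  have "closed S" unfolding S_def
    by (intro continuous_on_closed_Collect_le c continuous_intros closed_atLeastAtMost)
  moreover have "bounded S" by (rule bounded_subset[OF bounded_closed_interval[of d \<theta>]]) (auto simp: S_def)
  moreover have "s \<in> S" using neg s d by (auto simp: S_def not_less) (meson linear not_less)
  ultimately obtain z where z: "z \<in> S" "\<And>x. x \<in> S \<Longrightarrow> z \<le> x"
    using compact_attains_inf[of S] by (auto simp: compact_eq_bounded_closed)
  have u_pos: "0 < u x" if "0 < x" "x < z" for x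
    using d(3)[of x] z(2)[of x] z(1) that by (auto simp: S_def not_le) (meson not_le linear order_less_le_trans)
  have zd: "d \<le> z" "z \<le> \<theta>" "u z \<le> 0" using z(1) by (auto simp: S_def)
  have "u d / v d \<le> u z / v z"
    by (rule jacobi_ratio_mono[OF jacobi_solution_subinterval[OF u zd(2)] jacobi_solution_subinterval[OF v zd(2)]])
      (use le u_pos v_pos d zd in \<open>auto intro: less_imp_le\<close>)
  moreover have "0 < u d / v d" using d v_pos[of d] by simp
  moreover have "u z / v z \<le> 0" using zd d v_pos[of z] by (simp add: divide_nonpos_pos)
  ultimately show False by simp
qed

lemma sigma_cont_mono:
  assumes \<theta>: "0 < \<theta>" and t: "0 < t" "t < 1"
    and c: "continuous_on {0..\<theta>} \<kappa>1" "continuous_on {0..\<theta>} \<kappa>2"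
    and le: "\<And>s. s \<in> {0..\<theta>} \<Longrightarrow> \<kappa>1 s \<le> \<kappa>2 s"
  shows "sigma_cont \<kappa>1 t \<theta> \<le> sigma_cont \<kappa>2 t \<theta>"
proof (cases "\<forall>s\<in>{0<..\<theta>}. 0 < gen_sin \<kappa>2 \<theta> s")
  case True
  let ?u = "gen_sin \<kappa>1 \<theta>" and ?v = "gen_sin \<kappa>2 \<theta>"
  obtain u' v' where u: "jacobi_solution \<kappa>1 \<theta> ?u u'" and v: "jacobi_solution \<kappa>2 \<theta> ?v v'"
    using gen_sin_jacobi c \<theta> by (meson less_imp_le)
  have up: "\<forall>s\<in>{0<..\<theta>}. 0 < ?u s"
    using jacobi_positivity[OF u v le] True by blast
  have "?u (t * \<theta>) / ?v (t * \<theta>) \<le> ?u \<theta> / ?v \<theta>"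
    by (rule jacobi_ratio_mono[OF u v le]) (use up True \<theta> t in \<open>auto intro: less_imp_le simp: mult_le_cancel_right2\<close>)
  moreover have "t * \<theta> \<in> {0<..\<theta>}" using t \<theta> by (auto simp: mult_le_cancel_right2)
  then have "0 < ?v (t * \<theta>)" "0 < ?v \<theta>" "0 < ?u \<theta>" using up True \<theta> by auto
  ultimately have "?u (t * \<theta>) / ?u \<theta> \<le> ?v (t * \<theta>) / ?v \<theta>"
    by (simp add: field_simps)
  then show ?thesis using up True by (simp add: sigma_cont_def ennreal_leI)
qed (auto simp: sigma_cont_def)

text \<open>The comparison function is \<open>b s = s + K / 3 * s ^ 3\<close>. It satisfies \<open>b'' \<ge> K * b\<close> as long as
  \<open>K * s\<^sup>2 \<le> 3\<close>, which makes \<open>b / u\<close> nondecreasing for the solution \<open>u\<close>; and \<open>b (t * \<theta>) \<ge> t * \<theta>\<close>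
  while \<open>b \<theta> \<le> 2 * \<theta>\<close>. If \<open>u\<close> has a zero, the coefficient is infinite.\<close>

lemma sigma_cont_lower_bound:
  assumes \<theta>: "0 < \<theta>" and t: "0 < t" "t < 1"
    and c: "continuous_on {0..\<theta>} \<kappa>"
    and K: "0 \<le> K" "K * \<theta>\<^sup>2 \<le> 3" and le: "\<And>s. s \<in> {0..\<theta>} \<Longrightarrow> - K \<le> \<kappa> s"
  shows "ennreal (t / 2) \<le> sigma_cont \<kappa> t \<theta>"
proof (cases "\<forall>s\<in>{0<..\<theta>}. 0 < gen_sin \<kappa> \<theta> s")
  case True
  let ?v = "gen_sin \<kappa> \<theta>"
  define b where "b s = s + K / 3 * s ^ 3" for s
  obtain v' where v: "jacobi_solution \<kappa> \<theta> ?v v'"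
    using gen_sin_jacobi[OF _ c] \<theta> by auto
  have "b (t * \<theta>) / ?v (t * \<theta>) \<le> b \<theta> / ?v \<theta>"
  proof (rule sturm_ratio_mono[where z = \<theta> and u' = "\<lambda>s. 1 + K * s\<^sup>2" and f = "\<lambda>s. 2 * K * s"
        and v' = v' and g = "\<lambda>s. - (\<kappa> s * ?v s)"])
    fix s assume s: "s \<in> {0<..<\<theta>}"
    have "K * s\<^sup>2 \<le> K * \<theta>\<^sup>2" using s K by (intro mult_left_mono power_mono) auto
    then have "K * s\<^sup>2 \<le> 3" using K by simp
    then have "s * (K * s\<^sup>2) \<le> s * 3" using s by (intro mult_left_mono) auto
    then have b: "0 \<le> b s" "b s \<le> 2 * s"
      using s K by (auto simp: b_def power2_eq_square power3_eq_cube mult_ac)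
    have vs: "0 < ?v s" using True s by auto
    have "- \<kappa> s * (?v s * b s) \<le> K * (?v s * b s)"
      using le[of s] s b vs by (intro mult_right_mono) auto
    also have "\<dots> \<le> K * (?v s * (2 * s))"
      using b vs K by (intro mult_left_mono) auto
    finally show "- (\<kappa> s * ?v s) * b s \<le> 2 * K * s * ?v s" by (simp add: mult_ac)
  next
    fix s show "(b has_real_derivative 1 + K * s\<^sup>2) (at s within {0..\<theta>})"
      unfolding b_def by (rule derivative_eq_intros refl | simp add: power2_eq_square)+
    show "((\<lambda>s. 1 + K * s\<^sup>2) has_real_derivative 2 * K * s) (at s within {0..\<theta>})"
      by (rule derivative_eq_intros refl | simp)+
  qed (use v True \<theta> t in \<open>auto simp: jacobi_solution_def b_def mult_le_cancel_right2\<close>)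
  moreover have "t * \<theta> \<in> {0<..\<theta>}" using t \<theta> by (auto simp: mult_le_cancel_right2)
  then have vp: "0 < ?v (t * \<theta>)" "0 < ?v \<theta>" using True \<theta> by auto
  ultimately have 1: "b (t * \<theta>) * ?v \<theta> \<le> b \<theta> * ?v (t * \<theta>)"
    by (simp add: field_simps)
  have "\<theta> * (K * \<theta>\<^sup>2) \<le> \<theta> * 3" using K \<theta> by (intro mult_left_mono) auto
  then have "b \<theta> \<le> 2 * \<theta>" by (simp add: b_def power2_eq_square power3_eq_cube mult_ac)
  then have "b \<theta> * ?v (t * \<theta>) \<le> 2 * \<theta> * ?v (t * \<theta>)" using vp by (intro mult_right_mono) auto
  moreover have "t * \<theta> \<le> b (t * \<theta>)" using K t \<theta> by (simp add: b_def)
  then have "t * \<theta> * ?v \<theta> \<le> b (t * \<theta>) * ?v \<theta>" using vp by (intro mult_right_mono) auto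
  ultimately have "t * \<theta> * ?v \<theta> \<le> 2 * \<theta> * ?v (t * \<theta>)" using 1 by linarith
  then have "t / 2 \<le> ?v (t * \<theta>) / ?v \<theta>" using vp \<theta> by (simp add: field_simps)
  then show ?thesis using True by (simp add: sigma_cont_def ennreal_leI)
qed (auto simp: sigma_cont_def)

lemma
  assumes \<theta>: "0 \<le> \<theta>" and lb: "\<And>s. s \<in> {0..\<theta>} \<Longrightarrow> c \<le> \<kappa> s"
  shows lipschitz_approx_continuous: "continuous_on S (lipschitz_approx \<kappa> \<theta> n)"
    and lipschitz_approx_ge: "c \<le> lipschitz_approx \<kappa> \<theta> n s"
    and lipschitz_approx_mono: "n \<le> n' \<Longrightarrow> lipschitz_approx \<kappa> \<theta> n s \<le> lipschitz_approx \<kappa> \<theta> n' s"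
proof -
  have bdd: "bdd_below ((\<lambda>r. \<kappa> r + real n * \<bar>s - r\<bar>) ` {0..\<theta>})" for n s
    using lb by (intro bdd_belowI2[of _ c]) (simp add: add_increasing2)
  show "c \<le> lipschitz_approx \<kappa> \<theta> n s"
    unfolding lipschitz_approx_def using lb \<theta> by (intro cINF_greatest) (auto simp: add_increasing2)
  show "lipschitz_approx \<kappa> \<theta> n s \<le> lipschitz_approx \<kappa> \<theta> n' s" if "n \<le> n'"
    unfolding lipschitz_approx_def using \<theta> that by (intro cINF_mono bdd) (auto intro!: bexI mult_right_mono)
  have *: "lipschitz_approx \<kappa> \<theta> n x \<le> lipschitz_approx \<kappa> \<theta> n y + real n * \<bar>x - y\<bar>" for x y
  proof -
    have "lipschitz_approx \<kappa> \<theta> n x - real n * \<bar>x - y\<bar> \<le> lipschitz_approx \<kappa> \<theta> n y"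
      unfolding lipschitz_approx_def[of \<kappa> \<theta> n y]
    proof (rule cINF_greatest)
      fix r assume r: "r \<in> {0..\<theta>}"
      have "lipschitz_approx \<kappa> \<theta> n x \<le> \<kappa> r + real n * \<bar>x - r\<bar>"
        unfolding lipschitz_approx_def by (rule cINF_lower[OF bdd r])
      also have "real n * \<bar>x - r\<bar> \<le> real n * (\<bar>x - y\<bar> + \<bar>y - r\<bar>)" by (intro mult_left_mono) auto
      finally show "lipschitz_approx \<kappa> \<theta> n x - real n * \<bar>x - y\<bar> \<le> \<kappa> r + real n * \<bar>y - r\<bar>"
        by (simp add: algebra_simps)
    qed (use \<theta> in auto)
    then show ?thesis by simp
  qed
  have "(real n)-lipschitz_on S (lipschitz_approx \<kappa> \<theta> n)"
  proof (rule lipschitz_onI)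
    fix x y show "dist (lipschitz_approx \<kappa> \<theta> n x) (lipschitz_approx \<kappa> \<theta> n y) \<le> real n * dist x y"
      using *[of x y] *[of y x] by (simp add: dist_real_def abs_le_iff abs_minus_commute)
  qed simp
  then show "continuous_on S (lipschitz_approx \<kappa> \<theta> n)" by (rule lipschitz_on_continuous_on)
qed

text \<open>The Lipschitz approximations increase with \<open>n\<close> and stay above \<open>- K\<close>. By Sturm comparison their
  coefficients increase, so the defining limit exists, and it is at least the bound that holds already
  for \<open>n = 0\<close>.\<close>

lemma sigma_lower_bound:
  assumes \<theta>: "0 \<le> \<theta>" and t: "0 < t" "t < 1"
    and K: "0 \<le> K" "K * \<theta>\<^sup>2 \<le> 3" and le: "\<And>s. s \<in> {0..\<theta>} \<Longrightarrow> - K \<le> \<kappa> s"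
  shows "ennreal (t / 2) \<le> sigma \<kappa> t \<theta>"
proof (cases "\<theta> = 0")
  case False
  then have \<theta>': "0 < \<theta>" using \<theta> by simp
  let ?\<sigma> = "\<lambda>n. sigma_cont (lipschitz_approx \<kappa> \<theta> n) t \<theta>"
  have "incseq ?\<sigma>"
    by (intro incseq_SucI sigma_cont_mono \<theta>' t lipschitz_approx_continuous[OF \<theta> le]
        lipschitz_approx_mono[OF \<theta> le]) auto
  then have "?\<sigma> \<longlonglongrightarrow> (SUP n. ?\<sigma> n)" by (rule LIMSEQ_SUP)
  then have "lim ?\<sigma> = (SUP n. ?\<sigma> n)" by (rule limI)
  moreover have "ennreal (t / 2) \<le> ?\<sigma> 0"
    by (intro sigma_cont_lower_bound[OF \<theta>' t _ K] lipschitz_approx_continuous[OF \<theta> le]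
        lipschitz_approx_ge[OF \<theta> le]) auto
  ultimately show ?thesis using False by (auto simp: sigma_def intro: SUP_upper2)
qed (use t in \<open>auto simp: sigma_def intro!: ennreal_leI\<close>)

lemma epowr_mono: "x \<le> y \<Longrightarrow> 0 < a \<Longrightarrow> epowr x a \<le> epowr y a"
  by (auto simp: epowr_def top_unique intro!: ennreal_leI powr_mono2 enn2real_mono simp: less_top)

lemma tau_lower_bound:
  assumes N: "1 < N" and \<theta>: "0 \<le> \<theta>" and t: "0 < t" "t < 1"
    and K: "0 \<le> K" "K / (N - 1) * \<theta>\<^sup>2 \<le> 3" and le: "\<And>s. s \<in> {0..\<theta>} \<Longrightarrow> - K \<le> \<kappa> s"
  shows "ennreal (t / 2) \<le> tau \<kappa> N t \<theta>"
proof -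
  let ?q = "(N - 1) / N"
  have q: "0 < ?q" "?q \<le> 1" "1 / N + ?q = 1" using N by (auto simp: field_simps)
  have "ennreal (t / 2) \<le> sigma (\<lambda>s. \<kappa> s / (N - 1)) t \<theta>"
  proof (rule sigma_lower_bound[OF \<theta> t _ K(2)])
    fix s assume "s \<in> {0..\<theta>}"
    then show "- (K / (N - 1)) \<le> \<kappa> s / (N - 1)"
      using le[of s] N by (simp add: minus_divide_left divide_right_mono del: minus_divide_left[symmetric])
  qed (use N K in auto)
  then have "epowr (ennreal (t / 2)) ?q \<le> epowr (sigma (\<lambda>s. \<kappa> s / (N - 1)) t \<theta>) ?q"
    using q by (intro epowr_mono)
  then have *: "ennreal ((t / 2) powr ?q) \<le> epowr (sigma (\<lambda>s. \<kappa> s / (N - 1)) t \<theta>) ?q"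
    using t by (simp add: epowr_def)
  have "t / 2 = (t / 2) powr (1 / N) * (t / 2) powr ?q"
    unfolding powr_add[symmetric] q(3) using t by simp
  also have "\<dots> \<le> t powr (1 / N) * (t / 2) powr ?q"
    using t N by (intro mult_right_mono powr_mono2) auto
  finally have "ennreal (t / 2) \<le> ennreal (t powr (1 / N)) * ennreal ((t / 2) powr ?q)"
    by (subst ennreal_mult[symmetric]) (auto intro: ennreal_leI)
  also have "\<dots> \<le> ennreal (t powr (1 / N)) * epowr (sigma (\<lambda>s. \<kappa> s / (N - 1)) t \<theta>) ?q"
    by (intro mult_left_mono *) simp
  finally show ?thesis using N by (simp add: tau_def)
qed

section \<open>Intermediate points of Wasserstein geodesics\<close>

text \<open>The partition is given by the index \<open>i\<close> of its cells: a point is sent to the first member of a dense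
  sequence at distance less than \<open>\<delta> / 2\<close>.\<close>

lemma countable_borel_partition_small_diameter:
  assumes "0 < (\<delta>::real)"
  obtains i :: "'a::polish_space \<Rightarrow> nat" where "i \<in> measurable borel (count_space UNIV)"
    and "\<And>y z. i y = i z \<Longrightarrow> dist y z < \<delta>"
proof -
  obtain D :: "'a set" where D: "countable D" "\<And>X. open X \<Longrightarrow> X \<noteq> {} \<Longrightarrow> \<exists>d\<in>D. d \<in> X"
    using countable_dense_exists by blast
  have "D \<noteq> {}" using D(2)[of UNIV] by auto
  have ex: "\<exists>n. dist z (from_nat_into D n) < \<delta> / 2" for z
  proof -
    obtain d where "d \<in> D" "d \<in> ball z (\<delta> / 2)"
      using D(2)[of "ball z (\<delta> / 2)"] assms by auto
    then show ?thesis
      using from_nat_into_to_nat_on[OF D(1)] by (metis mem_ball)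
  qed
  define i where "i z = (LEAST n. dist z (from_nat_into D n) < \<delta> / 2)" for z
  have i: "dist z (from_nat_into D (i z)) < \<delta> / 2" for z
    unfolding i_def by (rule LeastI_ex[OF ex])
  show thesis
  proof
    show "i \<in> measurable borel (count_space UNIV)"
      unfolding i_def by measurable
    show "dist y z < \<delta>" if "i y = i z" for y z
      using dist_triangle_half_l[of y "from_nat_into D (i y)" \<delta> z] i[of y] i[of z] that
      by (simp add: dist_commute)
  qed
qed

lemma couplingsD:
  fixes \<pi> :: "('a::polish_space \<times> 'a) measure"
  assumes "\<pi> \<in> couplings \<mu> \<nu>"
  shows "sets \<pi> = sets borel" "prob_space \<pi>" "distr \<pi> borel fst = \<mu>" "distr \<pi> borel snd = \<nu>"
    "space \<pi> = UNIV"
  using assms sets_eq_imp_space_eq[of \<pi> borel] by (auto simp: couplings_def)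

text \<open>Gluing two couplings exactly along their common marginal requires disintegration. Along a
  countable partition into small cells it is elementary: within each cell the two couplings are made
  independent. With \<open>i\<close> the index of the cell and \<open>p n\<close> the \<open>\<mu>\<close>-mass of cell \<open>n\<close>, this is the product
  \<open>\<pi>0 \<Otimes>\<^sub>M \<pi>1\<close> with the density \<open>h ((y, z), (z', w)) = 1 / p (i z)\<close> where \<open>i z = i z'\<close>, and \<open>0\<close>
  elsewhere. Since the cells without mass form a null set, integrating out either factor gives \<open>1\<close>
  almost everywhere, so both marginals are kept, and \<open>z\<close> and \<open>z'\<close>
  agree up to \<open>\<delta>\<close>.\<close>

lemma approximate_gluing:
  fixes \<mu> \<nu>0 \<nu>1 :: "'a::polish_space measure"
  assumes \<pi>0: "\<pi>0 \<in> couplings \<nu>0 \<mu>" and \<pi>1: "\<pi>1 \<in> couplings \<mu> \<nu>1" and \<delta>: "0 < \<delta>"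
  obtains \<Gamma> where "sets \<Gamma> = sets (borel :: (('a \<times> 'a) \<times> ('a \<times> 'a)) measure)"
    and "distr \<Gamma> borel fst = \<pi>0" and "distr \<Gamma> borel snd = \<pi>1"
    and "AE q in \<Gamma>. dist (snd (fst q)) (fst (snd q)) < \<delta>"
proof -
  obtain i :: "'a \<Rightarrow> nat" where i[measurable]: "i \<in> measurable borel (count_space UNIV)"
    and i_dist: "\<And>y z. i y = i z \<Longrightarrow> dist y z < \<delta>"
    using countable_borel_partition_small_diameter[OF \<delta>] by blast
  note s0 = couplingsD[OF \<pi>0] and s1 = couplingsD[OF \<pi>1]
  interpret p0: prob_space \<pi>0 by (rule s0)
  interpret p1: prob_space \<pi>1 by (rule s1)
  interpret pair_sigma_finite \<pi>0 \<pi>1 ..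
  have [measurable_cong]: "sets \<pi>0 = sets (borel \<Otimes>\<^sub>M borel)" "sets \<pi>1 = sets (borel \<Otimes>\<^sub>M borel)"
    unfolding borel_prod by (rule s0 s1)+
  have \<mu>_sets: "sets \<mu> = sets borel" using s0(4) by auto
  have \<mu>_prob: "prob_space \<mu>" unfolding s0(4)[symmetric] by (rule p0.prob_space_distr) simp
  define p where "p n = emeasure \<mu> (i -` {n})" for n
  have p_fin: "p n \<noteq> \<infinity>" for n
    using prob_space.emeasure_le_1[OF \<mu>_prob, of "i -` {n}"] unfolding p_def by (auto simp: top_unique)
  have iset: "i -` {n} \<in> sets borel" for n
    using measurable_sets[OF i, of "{n}"] by simp
  have p0: "emeasure \<pi>0 {z. i (snd z) = n} = p n" for n
  proof -
    have "p n = emeasure (distr \<pi>0 borel snd) (i -` {n})" by (simp add: p_def s0)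
    also have "\<dots> = emeasure \<pi>0 (snd -` (i -` {n}) \<inter> space \<pi>0)"
      by (rule emeasure_distr[OF _ iset]) measurable
    finally show ?thesis by (simp add: s0 vimage_def)
  qed
  have p1: "emeasure \<pi>1 {z. i (fst z) = n} = p n" for n
  proof -
    have "p n = emeasure (distr \<pi>1 borel fst) (i -` {n})" by (simp add: p_def s1)
    also have "\<dots> = emeasure \<pi>1 (fst -` (i -` {n}) \<inter> space \<pi>1)"
      by (rule emeasure_distr[OF _ iset]) measurable
    finally show ?thesis by (simp add: s1 vimage_def)
  qed
  have iset0: "{z. i (snd z) = n} \<in> sets \<pi>0" and iset1: "{z. i (fst z) = n} \<in> sets \<pi>1" for n
  proof -
    have "{z \<in> space \<pi>0. i (snd z) = n} \<in> sets \<pi>0" "{z \<in> space \<pi>1. i (fst z) = n} \<in> sets \<pi>1"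
      by measurable
    then show "{z. i (snd z) = n} \<in> sets \<pi>0" "{z. i (fst z) = n} \<in> sets \<pi>1"
      by (simp_all add: s0(5) s1(5))
  qed
  have p_nz: "AE y in \<mu>. p (i y) \<noteq> 0"
  proof (rule AE_I')
    show "(\<Union>n\<in>{n. p n = 0}. i -` {n}) \<in> null_sets \<mu>"
      by (intro null_sets_UN') (auto simp: null_sets_def p_def iset \<mu>_sets)
  qed auto
  have nz0: "AE z in \<pi>0. p (i (snd z)) \<noteq> 0"
    by (rule AE_distrD[where M' = borel]) (use p_nz in \<open>simp_all only: s0(4)\<close>, measurable)
  have nz1: "AE z in \<pi>1. p (i (fst z)) \<noteq> 0"
    by (rule AE_distrD[where M' = borel]) (use p_nz in \<open>simp_all only: s1(3)\<close>, measurable)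
  define h where "h q = (if i (snd (fst q)) = i (fst (snd q)) then inverse (p (i (snd (fst q)))) else 0)"
    for q :: "('a \<times> 'a) \<times> ('a \<times> 'a)"
  have h[measurable]: "h \<in> borel_measurable (\<pi>0 \<Otimes>\<^sub>M \<pi>1)"
  proof -
    have i0[measurable]: "(\<lambda>q. i (snd (fst q))) \<in> measurable (\<pi>0 \<Otimes>\<^sub>M \<pi>1) (count_space UNIV)"
      and i1[measurable]: "(\<lambda>q. i (fst (snd q))) \<in> measurable (\<pi>0 \<Otimes>\<^sub>M \<pi>1) (count_space UNIV)"
      by measurable
    show ?thesis
      unfolding h_def
      by (rule measurable_compose_countable[OF _ i0, of "\<lambda>n q. if n = i (fst (snd q)) then inverse (p n) else 0"])
        measurable
  qed
  have inner0: "(\<integral>\<^sup>+z'. h (z, z') \<partial>\<pi>1) = 1" if "p (i (snd z)) \<noteq> 0" for z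
  proof -
    have "(\<integral>\<^sup>+z'. h (z, z') \<partial>\<pi>1) =
        (\<integral>\<^sup>+z'. inverse (p (i (snd z))) * indicator {z'. i (fst z') = i (snd z)} z' \<partial>\<pi>1)"
      by (intro nn_integral_cong) (auto simp: h_def indicator_def)
    also have "\<dots> = inverse (p (i (snd z))) * p (i (snd z))"
      using iset1 by (subst nn_integral_cmult_indicator) (auto simp: p1)
    also have "\<dots> = 1"
      using that p_fin by (simp add: mult.commute divide_ennreal_def[symmetric] ennreal_divide_self less_top)
    finally show ?thesis .
  qed
  have inner1: "(\<integral>\<^sup>+z. h (z, z') \<partial>\<pi>0) = 1" if "p (i (fst z')) \<noteq> 0" for z'
  proof -
    have "(\<integral>\<^sup>+z. h (z, z') \<partial>\<pi>0) =
        (\<integral>\<^sup>+z. inverse (p (i (fst z'))) * indicator {z. i (snd z) = i (fst z')} z \<partial>\<pi>0)"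
      by (intro nn_integral_cong) (auto simp: h_def indicator_def)
    also have "\<dots> = inverse (p (i (fst z'))) * p (i (fst z'))"
      using iset0 by (subst nn_integral_cmult_indicator) (auto simp: p0)
    also have "\<dots> = 1"
      using that p_fin by (simp add: mult.commute divide_ennreal_def[symmetric] ennreal_divide_self less_top)
    finally show ?thesis .
  qed
  define \<Gamma> where "\<Gamma> = density (\<pi>0 \<Otimes>\<^sub>M \<pi>1) h"
  show thesis
  proof
    have "sets (\<pi>0 \<Otimes>\<^sub>M \<pi>1) = sets ((borel :: ('a \<times> 'a) measure) \<Otimes>\<^sub>M (borel :: ('a \<times> 'a) measure))"
      using s0 s1 by (intro sets_pair_measure_cong) auto
    then show sets_\<Gamma>: "sets \<Gamma> = sets borel" by (simp only: \<Gamma>_def sets_density borel_prod)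
    have fst_\<Gamma>: "fst \<in> measurable \<Gamma> borel" and snd_\<Gamma>: "snd \<in> measurable \<Gamma> borel"
      using measurable_cong_sets[OF sets_\<Gamma> refl, of borel] borel_measurable_continuous_onI[OF continuous_on_fst[OF continuous_on_id]]
        borel_measurable_continuous_onI[OF continuous_on_snd[OF continuous_on_id]] by auto
    show "distr \<Gamma> borel fst = \<pi>0"
    proof (rule measure_eqI)
      fix A assume A: "A \<in> sets (distr \<Gamma> borel fst)"
      then have A0[measurable]: "A \<in> sets \<pi>0" using s0 by simp
      have "emeasure (distr \<Gamma> borel fst) A = emeasure \<Gamma> (fst -` A \<inter> space \<Gamma>)"
        using A by (intro emeasure_distr fst_\<Gamma>) simp
      also have "fst -` A \<inter> space \<Gamma> = A \<times> space \<pi>1"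
        using sets.sets_into_space[OF A0] by (auto simp: \<Gamma>_def space_pair_measure s0 s1)
      also have "emeasure \<Gamma> (A \<times> space \<pi>1) = (\<integral>\<^sup>+q. h q * indicator (A \<times> space \<pi>1) q \<partial>(\<pi>0 \<Otimes>\<^sub>M \<pi>1))"
        unfolding \<Gamma>_def by (rule emeasure_density) auto
      also have "\<dots> = (\<integral>\<^sup>+z. \<integral>\<^sup>+z'. h (z, z') * indicator (A \<times> space \<pi>1) (z, z') \<partial>\<pi>1 \<partial>\<pi>0)"
        by (rule p1.nn_integral_fst[symmetric]) auto
      also have "\<dots> = (\<integral>\<^sup>+z. (\<integral>\<^sup>+z'. h (z, z') \<partial>\<pi>1) * indicator A z \<partial>\<pi>0)"
        by (intro nn_integral_cong) (auto simp: indicator_def s1)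
      also have "\<dots> = (\<integral>\<^sup>+z. indicator A z \<partial>\<pi>0)"
        using nz0 by (intro nn_integral_cong_AE) (auto simp: inner0)
      finally show "emeasure (distr \<Gamma> borel fst) A = emeasure \<pi>0 A" by simp
    qed (use s0 in simp)
    show "distr \<Gamma> borel snd = \<pi>1"
    proof (rule measure_eqI)
      fix A assume A: "A \<in> sets (distr \<Gamma> borel snd)"
      then have A0[measurable]: "A \<in> sets \<pi>1" using s1 by simp
      have "emeasure (distr \<Gamma> borel snd) A = emeasure \<Gamma> (snd -` A \<inter> space \<Gamma>)"
        using A by (intro emeasure_distr snd_\<Gamma>) simp
      also have "snd -` A \<inter> space \<Gamma> = space \<pi>0 \<times> A"
        using sets.sets_into_space[OF A0] by (auto simp: \<Gamma>_def space_pair_measure s0 s1)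
      also have "emeasure \<Gamma> (space \<pi>0 \<times> A) = (\<integral>\<^sup>+q. h q * indicator (space \<pi>0 \<times> A) q \<partial>(\<pi>0 \<Otimes>\<^sub>M \<pi>1))"
        unfolding \<Gamma>_def by (rule emeasure_density) auto
      also have "\<dots> = (\<integral>\<^sup>+z'. \<integral>\<^sup>+z. h (z, z') * indicator (space \<pi>0 \<times> A) (z, z') \<partial>\<pi>0 \<partial>\<pi>1)"
        by (rule nn_integral_snd[symmetric]) auto
      also have "\<dots> = (\<integral>\<^sup>+z'. (\<integral>\<^sup>+z. h (z, z') \<partial>\<pi>0) * indicator A z' \<partial>\<pi>1)"
        by (intro nn_integral_cong) (auto simp: indicator_def s0)
      also have "\<dots> = (\<integral>\<^sup>+z'. indicator A z' \<partial>\<pi>1)"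
        using nz1 by (intro nn_integral_cong_AE) (auto simp: inner1)
      finally show "emeasure (distr \<Gamma> borel snd) A = emeasure \<pi>1 A" by simp
    qed (use s1 in simp)
    show "AE q in \<Gamma>. dist (snd (fst q)) (fst (snd q)) < \<delta>"
      unfolding \<Gamma>_def AE_density[OF h] by (rule AE_I2) (auto simp: h_def i_dist split: if_splits)
  qed
qed

text \<open>The distance \<^const>\<open>W2\<close> is defined through \<^const>\<open>enn2real\<close>, which sends \<open>\<infinity>\<close> to \<open>0\<close>. Finiteness of
  the infimum, witnessed by the product coupling, ensures that \<^const>\<open>W2\<close> is the square root of the
  actual optimal cost.\<close>

lemma P2_finite_cost:
  fixes \<mu> \<nu> :: "'a::polish_space measure"
  assumes \<mu>: "\<mu> \<in> P2" and \<nu>: "\<nu> \<in> P2"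
  shows "(INF \<pi>\<in>couplings \<mu> \<nu>. transport_cost \<pi>) < \<infinity>"
proof -
  have m[measurable_cong]: "sets \<mu> = sets borel" "sets \<nu> = sets borel" and p: "prob_space \<mu>" "prob_space \<nu>"
    using \<mu> \<nu> by (auto simp: P2_def)
  interpret M: prob_space \<mu> by fact
  interpret N: prob_space \<nu> by fact
  interpret pair_prob_space \<mu> \<nu> ..
  obtain a b where a: "(\<integral>\<^sup>+x. ennreal ((dist a x)\<^sup>2) \<partial>\<mu>) < \<infinity>" and b: "(\<integral>\<^sup>+x. ennreal ((dist b x)\<^sup>2) \<partial>\<nu>) < \<infinity>"
    using \<mu> \<nu> by (auto simp: P2_def)
  let ?\<pi> = "\<mu> \<Otimes>\<^sub>M \<nu>"
  have sp: "sets ?\<pi> = sets borel"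
    by (rule sets_pair_measure_cong[OF m, unfolded borel_prod])
  have f: "distr ?\<pi> borel fst = \<mu>" 
    using N.distr_pair_fst[of \<mu>] distr_cong[of ?\<pi> ?\<pi> borel \<mu> fst fst] m by simp
  have s: "distr ?\<pi> borel snd = \<nu>"
  proof (rule measure_eqI)
    fix A assume "A \<in> sets (distr ?\<pi> borel snd)"
    then have A: "A \<in> sets \<nu>" using m by simp
    have "snd -` A \<inter> space ?\<pi> = space \<mu> \<times> A"
      using sets.sets_into_space[OF A] by (auto simp: space_pair_measure)
    then show "emeasure (distr ?\<pi> borel snd) A = emeasure \<nu> A"
      using A m N.emeasure_pair_measure_Times[OF sets.top A, of \<mu>]
      by (simp add: emeasure_distr M.emeasure_space_1)
  qed (simp add: m)
  have "?\<pi> \<in> couplings \<mu> \<nu>"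
    using sp f s by (simp add: couplings_def prob_space_axioms)
  moreover have "transport_cost ?\<pi> < \<infinity>"
  proof -
    have "transport_cost ?\<pi> \<le> (\<integral>\<^sup>+z. 3 * ennreal ((dist a (fst z))\<^sup>2) + 3 * ennreal ((dist a b)\<^sup>2) + 3 * ennreal ((dist b (snd z))\<^sup>2) \<partial>?\<pi>)"
      unfolding transport_cost_def
    proof (rule nn_integral_mono)
      fix z :: "'a \<times> 'a"
      let ?x = "dist a (fst z)" and ?y = "dist a b" and ?z = "dist b (snd z)"
      have "dist (fst z) (snd z) \<le> ?x + ?y + ?z"
        by (metis add.commute add.left_commute dist_commute dist_triangle_le dist_triangle order_trans add_left_mono)
      then have "(dist (fst z) (snd z))\<^sup>2 \<le> (?x + ?y + ?z)\<^sup>2" by (intro power_mono) auto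
      also have "\<dots> \<le> 3 * ?x\<^sup>2 + 3 * ?y\<^sup>2 + 3 * ?z\<^sup>2"
        using sum_squares_ge_zero[of "?x - ?y" "?y - ?z"] zero_le_power2[of "?x - ?z"]
        by (simp add: power2_eq_square algebra_simps)
      finally show "ennreal ((dist (fst z) (snd z))\<^sup>2) \<le> 3 * ennreal (?x\<^sup>2) + 3 * ennreal (?y\<^sup>2) + 3 * ennreal (?z\<^sup>2)"
        by (simp add: ennreal_plus[symmetric] ennreal_mult'[symmetric] ennreal_leI flip: ennreal_numeral del: ennreal_plus)
    qed
    also have "\<dots> = 3 * (\<integral>\<^sup>+z. ennreal ((dist a (fst z))\<^sup>2) \<partial>?\<pi>) + 3 * ennreal ((dist a b)\<^sup>2) + 3 * (\<integral>\<^sup>+z. ennreal ((dist b (snd z))\<^sup>2) \<partial>?\<pi>)"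
      by (simp add: nn_integral_add nn_integral_cmult P.emeasure_space_1)
    also have "(\<integral>\<^sup>+z. ennreal ((dist a (fst z))\<^sup>2) \<partial>?\<pi>) = (\<integral>\<^sup>+x. ennreal ((dist a x)\<^sup>2) \<partial>\<mu>)"
      by (subst f[symmetric], subst nn_integral_distr) auto
    also have "(\<integral>\<^sup>+z. ennreal ((dist b (snd z))\<^sup>2) \<partial>?\<pi>) = (\<integral>\<^sup>+x. ennreal ((dist b x)\<^sup>2) \<partial>\<nu>)"
      by (subst s[symmetric], subst nn_integral_distr) auto
    finally show ?thesis
      using a b by (elim le_less_trans) (simp add: ennreal_mult_less_top ennreal_mult_eq_top_iff less_top)
  qed
  ultimately show ?thesis by (meson INF_lower le_less_trans)
qed

lemma W2_squared:
  fixes \<mu> \<nu> :: "'a::polish_space measure"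
  assumes "\<mu> \<in> P2" "\<nu> \<in> P2"
  shows "ennreal ((W2 \<mu> \<nu>)\<^sup>2) = (INF \<pi>\<in>couplings \<mu> \<nu>. transport_cost \<pi>)"
  using P2_finite_cost[OF assms] by (simp add: W2_def)

lemma almost_optimal_coupling:
  fixes \<mu> \<nu> :: "'a::polish_space measure"
  assumes "\<mu> \<in> P2" "\<nu> \<in> P2" "0 < \<eta>"
  obtains \<pi> where "\<pi> \<in> couplings \<mu> \<nu>" "transport_cost \<pi> \<le> ennreal ((W2 \<mu> \<nu>)\<^sup>2 + \<eta>)"
proof -
  have "(INF \<pi>\<in>couplings \<mu> \<nu>. transport_cost \<pi>) < ennreal ((W2 \<mu> \<nu>)\<^sup>2 + \<eta>)"
    unfolding W2_squared[OF assms(1,2), symmetric] using assms(3) by (intro ennreal_lessI) (auto intro: add_nonneg_pos)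
  then show thesis using that by (auto simp: INF_less_iff intro: less_imp_le)
qed

text \<open>For \<open>c = a + b\<close> this rests on the identity
  \<open>a\<^sup>2 / t + b\<^sup>2 / (1 - t) = c\<^sup>2 + (a - t * c)\<^sup>2 / (t * (1 - t))\<close>: the excess over \<open>c\<^sup>2\<close> measures how far
  the intermediate point is from dividing the segment in the ratio \<open>t : 1 - t\<close>. The error \<open>\<delta>\<close> in the
  triangle inequality is absorbed by passing to \<open>c' = max 0 (c - \<delta>)\<close>; when \<open>a > c'\<close>, the term \<open>a\<^sup>2 / t\<close> alone is large enough. If \<open>a > t * D + \<epsilon>\<close>, then
  \<open>a\<close> exceeds \<open>t * c'\<close> by more than \<open>\<epsilon>\<close>.\<close>

lemma interpolation_inequality:
  fixes a b c t \<delta> D :: real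
  assumes t: "0 < t" "t < 1" and nn: "0 \<le> a" "0 \<le> b" "0 \<le> c" and tri: "c \<le> a + b + \<delta>" and cD: "c \<le> D"
    and \<delta>: "0 < \<delta>" and \<epsilon>: "0 < \<epsilon>"
  shows "c\<^sup>2 + (if t * D + \<epsilon> < a then \<epsilon>\<^sup>2 else 0) \<le> a\<^sup>2 / t + b\<^sup>2 / (1 - t) + 2 * \<delta> * D"
proof -
  define c' where "c' = max 0 (c - \<delta>)"
  have c': "0 \<le> c'" "c' \<le> D" "c' \<le> a + b" using nn cD tri \<delta> by (auto simp: c'_def)
  have 1: "c'\<^sup>2 + (a - t * c')\<^sup>2 \<le> a\<^sup>2 / t + b\<^sup>2 / (1 - t)"
  proof (cases "a \<le> c'")
    case True
    have "(c' - a)\<^sup>2 \<le> b\<^sup>2" using True c' by (intro power_mono) auto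
    then have "(c' - a)\<^sup>2 / (1 - t) \<le> b\<^sup>2 / (1 - t)" using t by (intro divide_right_mono) auto
    moreover have "a\<^sup>2 / t + (c' - a)\<^sup>2 / (1 - t) = c'\<^sup>2 + (a - t * c')\<^sup>2 / (t * (1 - t))"
      using t by (simp add: divide_simps) (simp add: power2_eq_square algebra_simps)
    moreover have "(a - t * c')\<^sup>2 * (t * (1 - t)) \<le> (a - t * c')\<^sup>2 * 1"
      using t by (intro mult_left_mono mult_le_one) auto
    then have "(a - t * c')\<^sup>2 \<le> (a - t * c')\<^sup>2 / (t * (1 - t))"
      using t by (simp add: field_simps)
    ultimately show ?thesis by linarith
  next
    case False
    have "t * (c'\<^sup>2 + (a - t * c')\<^sup>2) \<le> a\<^sup>2"
    proof -
      have k: "0 \<le> t * c'" "t * c' \<le> a" using False c' t by (auto intro: order_trans[OF mult_left_le_one_le])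
      have "(a - t * c') * (a - t * c') \<le> a * (a - t * c')" using k by (intro mult_right_mono) auto
      moreover have "c' * c' \<le> c' * a" using False c' by (intro mult_left_mono) auto
      ultimately have "c'\<^sup>2 + (a - t * c')\<^sup>2 \<le> a * (a + (1 - t) * c')"
        by (simp add: power2_eq_square algebra_simps)
      also have "\<dots> \<le> a * (a + (1 - t) * a)" using False c' t nn by (intro mult_left_mono add_left_mono) auto
      finally have "t * (c'\<^sup>2 + (a - t * c')\<^sup>2) \<le> t * (a * (a + (1 - t) * a))" using t by simp
      also have "\<dots> = (1 - (1 - t)\<^sup>2) * a\<^sup>2" by (simp add: power2_eq_square algebra_simps)
      also have "\<dots> \<le> 1 * a\<^sup>2" by (intro mult_right_mono) auto
      finally show ?thesis by simp
    qed
    then have "c'\<^sup>2 + (a - t * c')\<^sup>2 \<le> a\<^sup>2 / t" using t by (simp add: field_simps)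
    moreover have "0 \<le> b\<^sup>2 / (1 - t)" using t by simp
    ultimately show ?thesis by linarith
  qed
  have 2: "c\<^sup>2 \<le> c'\<^sup>2 + 2 * \<delta> * D"
  proof (cases "\<delta> \<le> c")
    case True
    have "\<delta> * c \<le> \<delta> * D" using cD \<delta> by (intro mult_left_mono) auto
    moreover have "0 \<le> \<delta> * \<delta>" by simp
    moreover have "c'\<^sup>2 = c\<^sup>2 - 2 * (\<delta> * c) + \<delta> * \<delta>"
      using True by (simp add: c'_def power2_eq_square algebra_simps)
    ultimately show ?thesis by linarith
  next
    case False
    \<comment> \<open>Here \<open>c' = 0\<close>.\<close>
    have "c * c \<le> \<delta> * D" using False nn cD \<delta> by (intro mult_mono) auto
    moreover have "0 \<le> \<delta> * D" using \<delta> nn cD by simp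
    ultimately show ?thesis using False by (simp add: c'_def power2_eq_square)
  qed
  have 3: "\<epsilon>\<^sup>2 \<le> (a - t * c')\<^sup>2" if "t * D + \<epsilon> < a"
  proof -
    have "t * c' \<le> t * D" using c' t by (intro mult_left_mono) auto
    then show ?thesis using that \<epsilon> by (intro power_mono) auto
  qed
  have "0 \<le> (a - t * c')\<^sup>2" by simp
  then have "(if t * D + \<epsilon> < a then \<epsilon>\<^sup>2 else 0) \<le> (a - t * c')\<^sup>2" using 3 by simp
  then show ?thesis using 1 2 by linarith
qed


text \<open>Glue almost optimal couplings of \<open>\<nu>0, \<mu>\<close> and of \<open>\<mu>, \<nu>1\<close> and integrate the pointwise
  interpolation inequality. The endpoints of the glued measure form a coupling of \<open>\<nu>0\<close> and \<open>\<nu>1\<close>,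
  so the integral of \<open>c\<^sup>2\<close> is at least \<open>W\<^sup>2\<close> for \<open>W = W2 \<nu>0 \<nu>1\<close>. The two costs add up to
  \<open>(t * W)\<^sup>2 / t + ((1 - t) * W)\<^sup>2 / (1 - t) = W\<^sup>2\<close>, up to an arbitrarily small error. Therefore the
  set where the intermediate point has moved by more than \<open>t * D + \<epsilon>\<close> has arbitrarily small mass.\<close>

lemma wasserstein_intermediate_concentrated:
  fixes x :: "'a::polish_space"
  assumes P2: "\<nu>0 \<in> P2" "\<mu> \<in> P2" "\<nu>1 \<in> P2" and t: "0 < t" "t < 1"
    and W0: "W2 \<nu>0 \<mu> = t * W2 \<nu>0 \<nu>1" and W1: "W2 \<mu> \<nu>1 = (1 - t) * W2 \<nu>0 \<nu>1"
    and \<nu>0: "AE y in \<nu>0. dist x y \<le> r" and \<nu>1: "AE w in \<nu>1. dist x w \<le> r'"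
    and r: "0 \<le> r" "0 \<le> r'" and \<epsilon>: "0 < \<epsilon>"
  shows "AE z in \<mu>. dist x z \<le> r + t * (r + r') + \<epsilon>"
proof -
  define D where "D = r + r'"
  define W where "W = W2 \<nu>0 \<nu>1"
  define B where "B = {z. r + t * D + \<epsilon> < dist x z}"
  have D: "0 \<le> D" using r by (simp add: D_def)
  have B[measurable]: "B \<in> sets borel" unfolding B_def by measurable
  have bound: "ennreal (\<epsilon>\<^sup>2) * emeasure \<mu> B \<le> ennreal (2 * e)" if e: "0 < e" for e
  proof -
    \<comment> \<open>Excess cost and gluing error are chosen to contribute at most \<open>e\<close> each.\<close>
    define \<eta> where "\<eta> = e * t * (1 - t)"
    define \<delta> where "\<delta> = e / (2 * D + 1)"
    have \<eta>: "0 < \<eta>" using e t by (simp add: \<eta>_def)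
    have \<delta>: "0 < \<delta>" "2 * \<delta> * D \<le> e" using e D by (auto simp: \<delta>_def field_simps)
    obtain \<pi>0 where \<pi>0: "\<pi>0 \<in> couplings \<nu>0 \<mu>" "transport_cost \<pi>0 \<le> ennreal ((t * W)\<^sup>2 + \<eta>)"
      using almost_optimal_coupling[OF P2(1,2) \<eta>] unfolding W0 W_def by blast
    obtain \<pi>1 where \<pi>1: "\<pi>1 \<in> couplings \<mu> \<nu>1" "transport_cost \<pi>1 \<le> ennreal (((1 - t) * W)\<^sup>2 + \<eta>)"
      using almost_optimal_coupling[OF P2(2,3) \<eta>] unfolding W1 W_def by blast
    note s0 = couplingsD[OF \<pi>0(1)] and s1 = couplingsD[OF \<pi>1(1)]
    obtain \<Gamma> where \<Gamma>: "sets \<Gamma> = sets (borel :: (('a \<times> 'a) \<times> ('a \<times> 'a)) measure)"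
      "distr \<Gamma> borel fst = \<pi>0" "distr \<Gamma> borel snd = \<pi>1"
      "AE q in \<Gamma>. dist (snd (fst q)) (fst (snd q)) < \<delta>"
      using approximate_gluing[OF \<pi>0(1) \<pi>1(1) \<delta>(1)] by blast
    have meas: "f \<in> measurable \<Gamma> borel" if "continuous_on UNIV f" for f :: "_ \<Rightarrow> 'c::topological_space"
      using borel_measurable_continuous_onI[OF that] measurable_cong_sets[OF \<Gamma>(1) refl] by blast
    have prob_\<Gamma>: "prob_space \<Gamma>"
      by (rule prob_space_distrD[of fst \<Gamma> borel]) (use \<Gamma>(2) s0 in \<open>auto intro!: meas continuous_intros\<close>)
    define y z z' w where "y q = fst (fst q)" and "z q = snd (fst q)" and "z' q = fst (snd q)" and "w q = snd (snd q)"
      for q :: "('a \<times> 'a) \<times> ('a \<times> 'a)"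
    have m[measurable]: "y \<in> measurable \<Gamma> borel" "z \<in> measurable \<Gamma> borel" "z' \<in> measurable \<Gamma> borel" "w \<in> measurable \<Gamma> borel"
      "fst \<in> measurable \<Gamma> borel" "snd \<in> measurable \<Gamma> borel"
      unfolding y_def z_def z'_def w_def by (auto intro!: meas continuous_intros)
    have b: "fst \<in> measurable (borel :: ('a \<times> 'a) measure) borel" "snd \<in> measurable (borel :: ('a \<times> 'a) measure) borel"
      by (auto intro!: borel_measurable_continuous_onI continuous_intros)
    have marg: "distr \<Gamma> borel y = \<nu>0" "distr \<Gamma> borel z = \<mu>" "distr \<Gamma> borel w = \<nu>1"
      using distr_distr[OF b(1) m(5)] distr_distr[OF b(2) m(5)] distr_distr[OF b(2) m(6)] s0 s1 \<Gamma>
      by (simp_all add: y_def[abs_def] z_def[abs_def] w_def[abs_def] comp_def)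
    have myw: "(\<lambda>q. (y q, w q)) \<in> measurable \<Gamma> borel"
      unfolding y_def w_def by (intro meas continuous_intros)
    have "distr \<Gamma> borel (\<lambda>q. (y q, w q)) \<in> couplings \<nu>0 \<nu>1"
      using distr_distr[OF b(1) myw] distr_distr[OF b(2) myw] marg prob_space.prob_space_distr[OF prob_\<Gamma> myw]
      by (simp add: couplings_def comp_def)
    then have "(INF \<pi>\<in>couplings \<nu>0 \<nu>1. transport_cost \<pi>) \<le> transport_cost (distr \<Gamma> borel (\<lambda>q. (y q, w q)))"
      by (rule INF_lower)
    also have "transport_cost (distr \<Gamma> borel (\<lambda>q. (y q, w q))) = (\<integral>\<^sup>+q. ennreal ((dist (y q) (w q))\<^sup>2) \<partial>\<Gamma>)"
      unfolding transport_cost_def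
      by (subst nn_integral_distr[OF myw]) (auto intro!: borel_measurable_continuous_onI continuous_intros)
    finally have c: "ennreal (W\<^sup>2) \<le> (\<integral>\<^sup>+q. ennreal ((dist (y q) (w q))\<^sup>2) \<partial>\<Gamma>)"
      unfolding W2_squared[OF P2(1,3), symmetric] W_def .
    have a: "(\<integral>\<^sup>+q. ennreal ((dist (y q) (z q))\<^sup>2) \<partial>\<Gamma>) \<le> ennreal ((t * W)\<^sup>2 + \<eta>)"
      using \<pi>0(2) unfolding \<Gamma>(2)[symmetric] transport_cost_def y_def z_def
      by (subst (asm) nn_integral_distr[OF m(5)]) (auto intro!: borel_measurable_continuous_onI continuous_intros)
    have b: "(\<integral>\<^sup>+q. ennreal ((dist (z' q) (w q))\<^sup>2) \<partial>\<Gamma>) \<le> ennreal (((1 - t) * W)\<^sup>2 + \<eta>)"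
      using \<pi>1(2) unfolding \<Gamma>(3)[symmetric] transport_cost_def z'_def w_def
      by (subst (asm) nn_integral_distr[OF m(6)]) (auto intro!: borel_measurable_continuous_onI continuous_intros)
    have AE_y: "AE q in \<Gamma>. dist x (y q) \<le> r"
      using \<nu>0 unfolding marg(1)[symmetric] by (subst (asm) AE_distr_iff) auto
    have AE_w: "AE q in \<Gamma>. dist x (w q) \<le> r'"
      using \<nu>1 unfolding marg(3)[symmetric] by (subst (asm) AE_distr_iff) auto
    have key: "AE q in \<Gamma>. ennreal ((dist (y q) (w q))\<^sup>2) + ennreal (\<epsilon>\<^sup>2) * indicator B (z q) \<le>
        ennreal (1 / t) * ennreal ((dist (y q) (z q))\<^sup>2) + ennreal (1 / (1 - t)) * ennreal ((dist (z' q) (w q))\<^sup>2) + ennreal e"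
      using AE_y AE_w \<Gamma>(4)
    proof eventually_elim
      case (elim q)
      let ?a = "dist (y q) (z q)" and ?b = "dist (z' q) (w q)" and ?c = "dist (y q) (w q)"
      have zz: "dist (z q) (z' q) \<le> \<delta>" using elim(3) by (simp add: z_def z'_def)
      have "?c \<le> ?a + (dist (z q) (z' q) + ?b)"
        by (meson add_left_mono dist_triangle order_trans)
      then have tri: "?c \<le> ?a + ?b + \<delta>" using zz by simp
      have cD: "?c \<le> D"
        using dist_triangle3[of "y q" "w q" x] elim(1,2) by (simp add: D_def)
      have "(if z q \<in> B then \<epsilon>\<^sup>2 else 0) \<le> (if t * D + \<epsilon> < ?a then \<epsilon>\<^sup>2 else 0)"
        using dist_triangle[of x "z q" "y q"] elim(1) by (auto simp: B_def)
      moreover have "?c\<^sup>2 + (if t * D + \<epsilon> < ?a then \<epsilon>\<^sup>2 else 0) \<le> ?a\<^sup>2 / t + ?b\<^sup>2 / (1 - t) + 2 * \<delta> * D"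
        by (rule interpolation_inequality[OF t _ _ _ tri cD \<delta>(1) \<epsilon>]) auto
      ultimately have "?c\<^sup>2 + (if z q \<in> B then \<epsilon>\<^sup>2 else 0) \<le> ?a\<^sup>2 / t + ?b\<^sup>2 / (1 - t) + e"
        using \<delta> by linarith
      then have "ennreal (?c\<^sup>2 + (if z q \<in> B then \<epsilon>\<^sup>2 else 0)) \<le> ennreal (?a\<^sup>2 / t + ?b\<^sup>2 / (1 - t) + e)"
        by (rule ennreal_leI)
      then show ?case
        using t e by (cases "z q \<in> B") (auto simp: ennreal_plus[symmetric] ennreal_mult'[symmetric] simp del: ennreal_plus)
    qed
    have "ennreal (W\<^sup>2) + ennreal (\<epsilon>\<^sup>2) * emeasure \<mu> B \<le>
        (\<integral>\<^sup>+q. ennreal ((dist (y q) (w q))\<^sup>2) \<partial>\<Gamma>) + (\<integral>\<^sup>+q. ennreal (\<epsilon>\<^sup>2) * indicator B (z q) \<partial>\<Gamma>)"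
    proof (rule add_mono[OF c])
      have "emeasure \<mu> B = (\<integral>\<^sup>+v. indicator B v \<partial>distr \<Gamma> borel z)"
        by (simp add: marg(2)[symmetric])
      also have "\<dots> = (\<integral>\<^sup>+q. indicator B (z q) \<partial>\<Gamma>)" by (subst nn_integral_distr) auto
      finally show "ennreal (\<epsilon>\<^sup>2) * emeasure \<mu> B \<le> (\<integral>\<^sup>+q. ennreal (\<epsilon>\<^sup>2) * indicator B (z q) \<partial>\<Gamma>)"
        by (simp add: nn_integral_cmult)
    qed
    also have "\<dots> = (\<integral>\<^sup>+q. ennreal ((dist (y q) (w q))\<^sup>2) + ennreal (\<epsilon>\<^sup>2) * indicator B (z q) \<partial>\<Gamma>)"
      by (subst nn_integral_add) auto
    also have "\<dots> \<le> (\<integral>\<^sup>+q. ennreal (1 / t) * ennreal ((dist (y q) (z q))\<^sup>2) +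
        ennreal (1 / (1 - t)) * ennreal ((dist (z' q) (w q))\<^sup>2) + ennreal e \<partial>\<Gamma>)"
      using key by (rule nn_integral_mono_AE)
    also have "\<dots> = ennreal (1 / t) * (\<integral>\<^sup>+q. ennreal ((dist (y q) (z q))\<^sup>2) \<partial>\<Gamma>) +
        ennreal (1 / (1 - t)) * (\<integral>\<^sup>+q. ennreal ((dist (z' q) (w q))\<^sup>2) \<partial>\<Gamma>) + ennreal e"
      by (simp add: nn_integral_add nn_integral_cmult prob_space.emeasure_space_1[OF prob_\<Gamma>])
    also have "\<dots> \<le> ennreal (1 / t) * ennreal ((t * W)\<^sup>2 + \<eta>) + ennreal (1 / (1 - t)) * ennreal (((1 - t) * W)\<^sup>2 + \<eta>) + ennreal e"
      by (intro add_mono mult_left_mono a b) auto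
    also have "\<dots> = ennreal (1 / t * ((t * W)\<^sup>2 + \<eta>) + 1 / (1 - t) * (((1 - t) * W)\<^sup>2 + \<eta>) + e)"
      using t e \<eta> by (simp add: ennreal_plus[symmetric] ennreal_mult[symmetric] del: ennreal_plus)
    also have "1 / t * ((t * W)\<^sup>2 + \<eta>) + 1 / (1 - t) * (((1 - t) * W)\<^sup>2 + \<eta>) + e = W\<^sup>2 + 2 * e"
      using t by (simp add: \<eta>_def divide_simps) (simp add: power2_eq_square algebra_simps)
    also have "ennreal (W\<^sup>2 + 2 * e) = ennreal (W\<^sup>2) + ennreal (2 * e)" using e by simp
    finally show ?thesis by (simp add: ennreal_add_left_cancel_le)
  qed
  have "ennreal (\<epsilon>\<^sup>2) * emeasure \<mu> B \<le> 0"
  proof (rule ennreal_le_epsilon)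
    fix e :: real assume "0 < e"
    then show "ennreal (\<epsilon>\<^sup>2) * emeasure \<mu> B \<le> 0 + ennreal e" using bound[of "e / 2"] by simp
  qed
  then have "emeasure \<mu> B = 0" using \<epsilon> by simp
  moreover have "sets \<mu> = sets borel" using P2(2) by (simp add: P2_def)
  ultimately have "B \<in> null_sets \<mu>" using B by (simp add: null_sets_def)
  then show ?thesis by (rule AE_I') (auto simp: B_def D_def)
qed

section \<open>Hausdorff measure and volume growth\<close>

lemma hausdorff_pre_le:
  assumes "A \<subseteq> (\<Union>i. U i)" "\<And>i. bounded (U i)" "\<And>i. diameter (U i) \<le> \<delta>"
  shows "hausdorff_pre s \<delta> A \<le> (\<Sum>i. hausdorff_weight s (U i :: 'a::metric_space set))"
  unfolding hausdorff_pre_def using assms by (intro INF_lower) auto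

lemma hausdorff_pre_Union_null:
  fixes A :: "nat \<Rightarrow> 'a::metric_space set"
  assumes null: "\<And>n. hausdorff_pre s \<delta> (A n) = 0"
  shows "hausdorff_pre s \<delta> (\<Union>n. A n) = 0"
proof -
  have "hausdorff_pre s \<delta> (\<Union>n. A n) \<le> 0"
  proof (rule ennreal_le_epsilon)
    fix e :: real assume e: "0 < e"
    have "\<exists>U. A n \<subseteq> (\<Union>i. U i) \<and> (\<forall>i. bounded (U i) \<and> diameter (U i) \<le> \<delta>) \<and>
        (\<Sum>i. hausdorff_weight s (U i)) < ennreal (e * (1/2) ^ Suc n)" for n
    proof -
      have "hausdorff_pre s \<delta> (A n) < ennreal (e * (1/2) ^ Suc n)" using null e by simp
      then show ?thesis unfolding hausdorff_pre_def INF_less_iff by blast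
    qed
    then obtain U where U: "\<And>n. A n \<subseteq> (\<Union>i. U n i)" "\<And>n i. bounded (U n i)"
        "\<And>n i. diameter (U n i) \<le> \<delta>"
        "\<And>n. (\<Sum>i. hausdorff_weight s (U n i)) < ennreal (e * (1/2) ^ Suc n)"
      by metis
    define V where "V j = case_prod U (prod_decode j)" for j
    have "(\<Union>n. A n) \<subseteq> (\<Union>j. V j)"
    proof
      fix x assume "x \<in> (\<Union>n. A n)"
      then obtain n i where "x \<in> U n i" using U(1) by blast
      then have "x \<in> V (prod_encode (n, i))" by (simp add: V_def)
      then show "x \<in> (\<Union>j. V j)" by blast
    qed
    then have "hausdorff_pre s \<delta> (\<Union>n. A n) \<le> (\<Sum>j. hausdorff_weight s (V j))"
      by (rule hausdorff_pre_le) (auto simp: V_def U split: prod.split)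
    also have "\<dots> = (\<Sum>j. (\<lambda>(n, i). hausdorff_weight s (U n i)) (prod_decode j))"
      by (intro suminf_cong) (simp add: V_def split: prod.split)
    also have "\<dots> = (\<Sum>n. \<Sum>i. hausdorff_weight s (U n i))"
      by (rule suminf_ennreal_2dimen) simp
    also have "\<dots> \<le> (\<Sum>n. ennreal (e * (1/2) ^ Suc n))"
      by (intro suminf_le less_imp_le U(4)) auto
    also have "\<dots> = ennreal e"
      using e sums_mult[OF power_half_series, of e]
      by (subst suminf_ennreal2) (auto simp: sums_iff)
    finally show "hausdorff_pre s \<delta> (\<Union>n. A n) \<le> 0 + ennreal e" by simp
  qed
  then show ?thesis by simp
qed

lemma hausdorff_measure_UNIV_null:
  assumes "\<And>x :: 'a::{metric_space, second_countable_topology}.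
    \<exists>U. open U \<and> x \<in> U \<and> (\<forall>\<delta>>0. hausdorff_pre s \<delta> U = 0)"
  shows "hausdorff_measure s (UNIV :: 'a set) = 0"
proof -
  define F where "F = {U :: 'a set. open U \<and> (\<forall>\<delta>>0. hausdorff_pre s \<delta> U = 0)}"
  obtain F' where F': "F' \<subseteq> F" "countable F'" "\<Union>F' = \<Union>F"
    using Lindelof[of F] unfolding F_def by blast
  have cover: "\<Union>F' = UNIV" using assms unfolding F' F_def by blast
  then have ne: "F' \<noteq> {}" by auto
  have "(\<Union>n. from_nat_into F' n) = UNIV"
    using cover by (simp add: range_from_nat_into[OF ne F'(2)])
  moreover have "hausdorff_pre s \<delta> (from_nat_into F' n) = 0" if "0 < \<delta>" for \<delta> n
    using from_nat_into[OF ne] F'(1) that unfolding F_def by blast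
  ultimately have "hausdorff_pre s \<delta> (UNIV :: 'a set) = 0" if "0 < \<delta>" for \<delta>
    using hausdorff_pre_Union_null[of s \<delta> "from_nat_into F'"] that by simp
  then show ?thesis by (simp add: hausdorff_measure_def)
qed

lemma separated_set_card_bound:
  fixes m :: "'a::metric_space measure"
  assumes m: "sets m = sets borel" and fin: "finite F"
    and sep: "pairwise (\<lambda>x y. 2 * r < dist x y) F"
    and growth: "\<And>x. x \<in> F \<Longrightarrow> ennreal g \<le> emeasure m (cball x r)"
    and B: "\<And>x. x \<in> F \<Longrightarrow> cball x r \<subseteq> B" "B \<in> sets borel"
  shows "of_nat (card F) * ennreal g \<le> emeasure m B"
proof -
  have "of_nat (card F) * ennreal g = (\<Sum>x\<in>F. ennreal g)" by simp
  also have "\<dots> \<le> (\<Sum>x\<in>F. emeasure m (cball x r))" by (intro sum_mono growth)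
  also have "\<dots> = emeasure m (\<Union>x\<in>F. cball x r)"
  proof (rule sum_emeasure)
    show "disjoint_family_on (\<lambda>x. cball x r) F"
      unfolding disjoint_family_on_def
    proof (intro ballI impI)
      fix x y assume xy: "x \<in> F" "y \<in> F" "x \<noteq> y"
      then have far: "2 * r < dist x y" using sep by (auto simp: pairwise_def)
      show "cball x r \<inter> cball y r = {}"
      proof (rule equals0I)
        fix z assume "z \<in> cball x r \<inter> cball y r"
        then show False using far dist_triangle2[of x y z] by simp
      qed
    qed
    show "(\<lambda>x. cball x r) ` F \<subseteq> sets m" unfolding m by (auto intro: borel_closed)
  qed (rule fin)
  also have "\<dots> \<le> emeasure m B" using B m by (intro emeasure_mono) auto
  finally show ?thesis .
qed

text \<open>A separated set of maximal cardinality is a net, since any point far from it could be added.\<close>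

lemma finite_net_of_bounded_cardinality:
  fixes A :: "'a::metric_space set"
  assumes r: "0 \<le> r" and "\<And>F. finite F \<Longrightarrow> F \<subseteq> A \<Longrightarrow> pairwise (\<lambda>x y. r < dist x y) F \<Longrightarrow> card F \<le> n"
  obtains F where "finite F" "F \<subseteq> A" "pairwise (\<lambda>x y. r < dist x y) F" "A \<subseteq> (\<Union>x\<in>F. cball x r)"
proof -
  define P where "P F \<longleftrightarrow> finite F \<and> F \<subseteq> A \<and> pairwise (\<lambda>x y. r < dist x y) F" for F
  have "P {}" by (simp add: P_def)
  then obtain F where F: "P F" "\<And>G. P G \<Longrightarrow> card G \<le> card F"
    using ex_has_greatest_nat[of P "{}" card "Suc n"] assms unfolding P_def
    by (auto simp: less_Suc_eq_le)
  have "x \<in> (\<Union>x\<in>F. cball x r)" if x: "x \<in> A" for x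
  proof (rule ccontr)
    assume far: "x \<notin> (\<Union>x\<in>F. cball x r)"
    then have "x \<notin> F" using r by force
    moreover have "P (insert x F)"
      using F(1) x far unfolding P_def by (auto simp: pairwise_insert dist_commute)
    ultimately show False using F(2)[of "insert x F"] F(1) by (simp add: P_def)
  qed
  then show thesis using F(1) that unfolding P_def by blast
qed

lemma diameter_cball_le:
  fixes x :: "'a::metric_space"
  assumes "0 \<le> r"
  shows "diameter (cball x r) \<le> 2 * r"
proof -
  have "dist y z \<le> 2 * r" if "y \<in> cball x r" "z \<in> cball x r" for y z
    using that dist_triangle3[of y z x] by simp
  moreover have "cball x r \<noteq> {}" using assms by auto
  ultimately show ?thesis by (auto simp: diameter_def intro!: cSUP_least)
qed

lemma hausdorff_pre_le_of_net:
  fixes A :: "'a::metric_space set"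
  assumes F: "finite F" and cover: "A \<subseteq> (\<Union>x\<in>F. cball x r)" and r: "0 < r" "2 * r \<le> \<delta>" and s: "0 < s"
  shows "hausdorff_pre s \<delta> A \<le> of_nat (card F) * ennreal ((2 * r) powr s)"
proof -
  obtain h where h: "bij_betw h {0..<card F} F" using ex_bij_betw_nat_finite[OF F] by blast
  define U where "U i = (if i < card F then cball (h i) r else {})" for i
  have "(\<Union>x\<in>F. cball x r) \<subseteq> (\<Union>i. U i)"
  proof
    fix y assume "y \<in> (\<Union>x\<in>F. cball x r)"
    then obtain i where "i < card F" "y \<in> cball (h i) r"
      using bij_betw_imp_surj_on[OF h] by force
    then have "y \<in> U i" by (simp add: U_def)
    then show "y \<in> (\<Union>i. U i)" by blast
  qed
  then have "hausdorff_pre s \<delta> A \<le> (\<Sum>i. hausdorff_weight s (U i))"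
  proof (intro hausdorff_pre_le)
    fix i
    show "bounded (U i)" by (simp add: U_def)
    show "diameter (U i) \<le> \<delta>"
      using r diameter_cball_le[of r "h i"] by (simp add: U_def)
  qed (use cover in auto)
  also have "\<dots> = (\<Sum>i<card F. hausdorff_weight s (U i))"
    by (rule suminf_finite) (auto simp: U_def hausdorff_weight_def)
  also have "\<dots> \<le> (\<Sum>i<card F. ennreal ((2 * r) powr s))"
  proof (rule sum_mono)
    fix i assume "i \<in> {..<card F}"
    have "diameter (cball (h i) r) powr s \<le> (2 * r) powr s"
      using r s by (intro powr_mono2 diameter_cball_le diameter_ge_0) auto
    then show "hausdorff_weight s (U i) \<le> ennreal ((2 * r) powr s)"
      using s by (auto simp: hausdorff_weight_def U_def intro: ennreal_leI)
  qed
  finally show ?thesis by simp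
qed

text \<open>A set in \<open>A\<close> whose points have mutual distance above \<open>2 * r\<close> has at most
  \<open>measure m B / (c * r powr p)\<close> elements, because the balls of radius \<open>r\<close> around them are disjoint. A
  maximal one covers \<open>A\<close> by balls of diameter at most \<open>4 * r\<close>, with total weight bounded by a multiple
  of \<open>r powr (s - p)\<close>, which tends to \<open>0\<close> with \<open>r\<close>.\<close>

lemma hausdorff_pre_null_of_volume_growth:
  fixes m :: "'a::metric_space measure"
  assumes m: "sets m = sets borel" and p: "0 < p" "p < s" and c: "0 < c" and r_max: "0 < r_max"
    and growth: "\<And>x r. x \<in> A \<Longrightarrow> 0 < r \<Longrightarrow> r < r_max \<Longrightarrow> ennreal (c * r powr p) \<le> emeasure m (cball x r)"
    and B: "\<And>x r. x \<in> A \<Longrightarrow> r < r_max \<Longrightarrow> cball x r \<subseteq> B" "B \<in> sets borel" "emeasure m B < \<infinity>"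
    and \<delta>: "0 < \<delta>"
  shows "hausdorff_pre s \<delta> A = 0"
proof -
  define M where "M = measure m B"
  have M: "emeasure m B = ennreal M" "0 \<le> M"
    using B(3) by (auto simp: M_def emeasure_eq_ennreal_measure less_top)
  define C where "C = M / c * 4 powr s"
  have C: "0 \<le> C" using M c by (simp add: C_def)
  have est: "hausdorff_pre s \<delta> A \<le> ennreal (C * r powr (s - p))" if r: "0 < r" "r < r_max" "4 * r \<le> \<delta>" for r
  proof -
    have card: "real (card F) * (c * r powr p) \<le> M"
      if F: "finite F" "F \<subseteq> A" "pairwise (\<lambda>x y. 2 * r < dist x y) F" for F
    proof -
      have "of_nat (card F) * ennreal (c * r powr p) \<le> emeasure m B"
        using F r by (intro separated_set_card_bound[OF m F(1,3)] growth B) auto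
      moreover have "ennreal (real (card F) * (c * r powr p)) = of_nat (card F) * ennreal (c * r powr p)"
        by (simp only: ennreal_mult'[OF of_nat_0_le_iff] ennreal_of_nat_eq_real_of_nat)
      ultimately have "ennreal (real (card F) * (c * r powr p)) \<le> ennreal M" by (simp only: M(1))
      then show ?thesis using M(2) by (simp only: ennreal_le_iff)
    qed
    have cr: "0 < c * r powr p" using c r by simp
    have "card F \<le> nat \<lceil>M / (c * r powr p)\<rceil>"
      if F: "finite F" "F \<subseteq> A" "pairwise (\<lambda>x y. 2 * r < dist x y) F" for F
    proof -
      have "real (card F) \<le> M / (c * r powr p)" using card[OF F] cr by (simp add: pos_le_divide_eq)
      then show ?thesis by linarith
    qed
    then obtain F where F: "finite F" "F \<subseteq> A" "pairwise (\<lambda>x y. 2 * r < dist x y) F"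
        "A \<subseteq> (\<Union>x\<in>F. cball x (2 * r))"
      using r by (elim finite_net_of_bounded_cardinality[rotated]) auto
    have "hausdorff_pre s \<delta> A \<le> of_nat (card F) * ennreal ((2 * (2 * r)) powr s)"
      using r p by (intro hausdorff_pre_le_of_net F) auto
    also have "\<dots> = ennreal (real (card F) * (4 * r) powr s)"
      by (simp only: ennreal_mult'[OF of_nat_0_le_iff] ennreal_of_nat_eq_real_of_nat) simp
    also have "\<dots> \<le> ennreal (C * r powr (s - p))"
    proof (rule ennreal_leI)
      have "real (card F) * (4 * r) powr s \<le> M / (c * r powr p) * (4 * r) powr s"
        using card[OF F(1-3)] cr by (intro mult_right_mono) (auto simp: pos_le_divide_eq)
      also have "\<dots> = C * r powr (s - p)"
        using r c by (simp add: C_def powr_mult powr_diff)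
      finally show "real (card F) * (4 * r) powr s \<le> C * r powr (s - p)" .
    qed
    finally show ?thesis .
  qed
  have "hausdorff_pre s \<delta> A \<le> 0"
  proof (rule ennreal_le_epsilon)
    fix e :: real assume e: "0 < e"
    \<comment> \<open>This radius solves \<open>(C + 1) * q powr (s - p) = e\<close>.\<close>
    define q where "q = (e / (C + 1)) powr (1 / (s - p))"
    have q: "0 < q" "q powr (s - p) = e / (C + 1)"
      using e C p by (auto simp: q_def powr_powr)
    define r where "r = min q (min (r_max / 2) (\<delta> / 4))"
    have r: "0 < r" "r < r_max" "4 * r \<le> \<delta>" "r \<le> q" using q r_max \<delta> by (auto simp: r_def)
    have "C * r powr (s - p) \<le> C * q powr (s - p)"
      using C r p by (intro mult_left_mono powr_mono2) auto
    also have "\<dots> \<le> e" using C e by (simp add: q field_simps)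
    finally have "ennreal (C * r powr (s - p)) \<le> ennreal e" by (rule ennreal_leI)
    then show "hausdorff_pre s \<delta> A \<le> 0 + ennreal e" using est[OF r(1-3)] by simp
  qed
  then show ?thesis by simp
qed

section \<open>Volume growth from the curvature-dimension condition\<close>

lemma metric_measure_space_sigma_finite:
  fixes m :: "'a::polish_space measure"
  assumes "metric_measure_space m"
  shows "sigma_finite_measure m"
proof -
  define F where "F = {U. open U \<and> emeasure m U < \<infinity>}"
  have sets: "sets m = sets borel" using assms by (simp add: metric_measure_space_def)
  obtain F' where F': "F' \<subseteq> F" "countable F'" "\<Union>F' = \<Union>F"
    using Lindelof[of F] unfolding F_def by blast
  have "x \<in> \<Union>F" for x
  proof -
    obtain r where "0 < r" "emeasure m (ball x r) < \<infinity>"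
      using assms unfolding metric_measure_space_def by blast
    then have "ball x r \<in> F" "x \<in> ball x r" by (auto simp: F_def)
    then show ?thesis by blast
  qed
  then have "\<Union>F' = space m"
    using F'(3) sets_eq_imp_space_eq[OF sets] by auto
  moreover have "F' \<subseteq> sets m" using F'(1) sets by (auto simp: F_def)
  moreover have "\<forall>a\<in>F'. emeasure m a \<noteq> \<infinity>" using F'(1) by (auto simp: F_def)
  ultimately show ?thesis using F'(2) unfolding sigma_finite_measure_def by blast
qed

text \<open>Normalised restrictions of \<open>m\<close> to bounded sets are admissible marginals for the
  curvature-dimension inequality, and their density is constant where they live.\<close>

lemma
  fixes m :: "'a::polish_space measure"
  assumes m: "sets m = sets borel" and A: "A \<in> sets borel" "A \<subseteq> cball x r"
    and pos: "0 < emeasure m A" "emeasure m A < \<infinity>"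
  shows uniform_measure_P2_ac: "uniform_measure m A \<in> P2_ac m"
    and bounded_support_uniform_measure: "bounded (measure_support (uniform_measure m A))"
    and RN_deriv_uniform_measure: "AE y in uniform_measure m A. RN_deriv m (uniform_measure m A) y = 1 / emeasure m A"
proof -
  let ?\<nu> = "uniform_measure m A"
  have Am[measurable]: "A \<in> sets m" using A m by simp
  have prob: "prob_space ?\<nu>" using pos by (intro prob_space_uniform_measure) auto
  interpret prob_space ?\<nu> by (rule prob)
  have sets: "sets ?\<nu> = sets borel" using m by simp
  have in_A: "AE y in ?\<nu>. y \<in> A"
    using pos by (intro AE_uniform_measureI) auto
  have "(\<integral>\<^sup>+y. ennreal ((dist x y)\<^sup>2) \<partial>?\<nu>) \<le> (\<integral>\<^sup>+y. ennreal (r\<^sup>2) \<partial>?\<nu>)"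
  proof (rule nn_integral_mono_AE)
    show "AE y in ?\<nu>. ennreal ((dist x y)\<^sup>2) \<le> ennreal (r\<^sup>2)"
      using in_A by eventually_elim (use A in \<open>auto intro!: ennreal_leI power_mono\<close>)
  qed
  also have "\<dots> < \<infinity>" using emeasure_space_1 by simp
  finally have "?\<nu> \<in> P2" using prob sets unfolding P2_def by blast
  moreover have "absolutely_continuous m ?\<nu>"
    unfolding uniform_measure_def by (rule absolutely_continuousI_density) measurable
  ultimately show "?\<nu> \<in> P2_ac m" by (simp add: P2_ac_def)
  have "measure_support ?\<nu> \<subseteq> cball x r"
  proof
    fix y assume y: "y \<in> measure_support ?\<nu>"
    show "y \<in> cball x r"
    proof (rule ccontr)
      assume "y \<notin> cball x r"
      then have "0 < emeasure ?\<nu> (- cball x r)"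
        using y unfolding measure_support_def by (simp add: open_Compl)
      moreover have "emeasure ?\<nu> (- cball x r) = emeasure m (A \<inter> - cball x r) / emeasure m A"
        by (rule emeasure_uniform_measure[OF Am]) (unfold m, rule borel_open, simp add: open_Compl)
      moreover have "A \<inter> - cball x r = {}" using A by auto
      ultimately show False by simp
    qed
  qed
  then show "bounded (measure_support ?\<nu>)" by (rule bounded_subset[OF bounded_cball])
  have "AE y in m. indicator A y / emeasure m A = RN_deriv m ?\<nu> y"
    by (rule RN_deriv_unique_sigma_finite[OF _ uniform_measure_def[symmetric] sigma_finite_measure_axioms])
      measurable
  then show "AE y in ?\<nu>. RN_deriv m ?\<nu> y = 1 / emeasure m A"
    unfolding AE_uniform_measure[OF pos(1)[THEN less_imp_neq, symmetric] pos(2)]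
  proof eventually_elim
    case (elim y)
    then show ?case by (auto simp: indicator_def)
  qed
qed

text \<open>The chosen density belongs to some Lebesgue decomposition, because the Radon--Nikodym derivative
  provides one, and the absolutely continuous part of a measure is dominated by the measure.\<close>

lemma ac_density_props:
  fixes m :: "'a::polish_space measure"
  assumes \<sigma>: "sigma_finite_measure m" and \<mu>: "absolutely_continuous m \<mu>" "sets \<mu> = sets m"
  shows "ac_density m \<mu> \<in> borel_measurable m"
    and "\<And>A. A \<in> sets m \<Longrightarrow> (\<integral>\<^sup>+x. ac_density m \<mu> x * indicator A x \<partial>m) \<le> emeasure \<mu> A"
proof -
  interpret sigma_finite_measure m by (rule \<sigma>)
  have "lebesgue_decomposition m \<mu> (RN_deriv m \<mu>) (null_measure m)"
    using density_RN_deriv[OF \<mu>] by (auto simp: lebesgue_decomposition_def intro!: bexI[of _ "{}"])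
  then have "\<exists>\<nu>s. lebesgue_decomposition m \<mu> (ac_density m \<mu>) \<nu>s"
    unfolding ac_density_def by (rule someI[where P = "\<lambda>\<rho>. \<exists>\<nu>s. lebesgue_decomposition m \<mu> \<rho> \<nu>s", OF exI])
  then obtain \<nu>s where D: "ac_density m \<mu> \<in> borel_measurable m"
    "\<And>A. A \<in> sets m \<Longrightarrow> emeasure \<mu> A = emeasure (density m (ac_density m \<mu>)) A + emeasure \<nu>s A"
    unfolding lebesgue_decomposition_def by blast
  show "ac_density m \<mu> \<in> borel_measurable m" by (rule D)
  fix A assume A: "A \<in> sets m"
  show "(\<integral>\<^sup>+x. ac_density m \<mu> x * indicator A x \<partial>m) \<le> emeasure \<mu> A"
    unfolding D(2)[OF A] emeasure_density[OF D(1) A] by simp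
qed

text \<open>A replacement for Jensen's inequality: the concave function \<open>r powr p\<close> is at most its constant value
  at \<open>l\<close> below \<open>l\<close>, and \<open>r * l powr (p - 1)\<close> above. Compared with the tangent at \<open>l\<close> this loses at
  most a factor, which changes only the constant in the volume growth.\<close>

lemma epowr_le_affine:
  assumes p: "0 < p" "p < 1" and l: "0 < l"
  shows "epowr \<rho> p \<le> ennreal (l powr p) + ennreal (l powr (p - 1)) * \<rho>"
proof (cases \<rho>)
  case (real r)
  have "r powr p \<le> l powr p + l powr (p - 1) * r"
  proof (cases "r \<le> l")
    case True
    then have "r powr p \<le> l powr p" using real p by (intro powr_mono2) auto
    moreover have "0 \<le> l powr (p - 1) * r" using real by simp
    ultimately show ?thesis by linarith
  next
    case False
    then have "r powr p = r powr (p - 1) * r" using l by (simp add: powr_mult_base' powr_diff)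
    also have "\<dots> \<le> l powr (p - 1) * r"
      using False l p real by (intro mult_right_mono powr_mono2') auto
    finally show ?thesis using powr_ge_zero[of l p] by linarith
  qed
  then have "ennreal (r powr p) \<le> ennreal (l powr p + l powr (p - 1) * r)" by (rule ennreal_leI)
  then show ?thesis using real p by (simp add: epowr_def ennreal_mult)
next
  case top
  then show ?thesis using l by (simp add: ennreal_mult_top)
qed

text \<open>The density vanishes outside \<open>B\<close> and has integral at most \<open>1\<close>. Integrating the affine bound over
  \<open>B\<close> with \<open>l = 1 / b\<close>, the mean density, bounds each of its two terms by \<open>b powr (1 / N)\<close>.\<close>

lemma entropy_integral_bound:
  fixes m :: "'a::polish_space measure"
  assumes \<sigma>: "sigma_finite_measure m" and m: "sets m = sets borel" and \<mu>: "\<mu> \<in> P2_ac m"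
    and B: "B \<in> sets borel" "AE z in \<mu>. z \<in> B" "emeasure m B = ennreal b" "0 < b" and N: "1 < N"
  shows "(\<integral>\<^sup>+x. epowr (ac_density m \<mu> x) (1 - 1 / N) \<partial>m) \<le> ennreal (2 * b powr (1 / N))"
proof -
  have \<mu>': "absolutely_continuous m \<mu>" "sets \<mu> = sets m" "prob_space \<mu>"
    using \<mu> m by (auto simp: P2_ac_def P2_def)
  interpret prob_space \<mu> by (rule \<mu>')
  define \<rho> where "\<rho> = ac_density m \<mu>"
  note \<rho> = ac_density_props[OF \<sigma> \<mu>'(1,2), folded \<rho>_def]
  note [measurable] = \<rho>(1)
  have Bm[measurable]: "B \<in> sets m" using B m by simp
  have spm: "space m = UNIV" using sets_eq_imp_space_eq[OF m] by simp
  have "emeasure \<mu> (- B) = 0"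
    using B(2) AE_iff_measurable[of "- B" \<mu> "\<lambda>z. z \<in> B"] \<mu>'(2) spm sets_eq_imp_space_eq[OF \<mu>'(2)] B m by auto
  then have "(\<integral>\<^sup>+x. \<rho> x * indicator (- B) x \<partial>m) = 0"
    using \<rho>(2)[of "- B"] B m by (metis Bm borel_comp le_zero_eq sets_eq_imp_space_eq)
  then have "AE x in m. \<rho> x * indicator (- B) x = 0"
    using B m by (subst (asm) nn_integral_0_iff_AE) auto
  then have out: "AE x in m. x \<notin> B \<longrightarrow> \<rho> x = 0" by eventually_elim (auto simp: indicator_def)
  define p where "p = 1 - 1 / N"
  define l where "l = 1 / b"
  have p: "0 < p" "p < 1" using N by (auto simp: p_def)
  have l: "0 < l" using B by (simp add: l_def)
  have "(\<integral>\<^sup>+x. epowr (\<rho> x) p \<partial>m) \<le>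
      (\<integral>\<^sup>+x. ennreal (l powr p) * indicator B x + ennreal (l powr (p - 1)) * (\<rho> x * indicator B x) \<partial>m)"
    using out
  proof (intro nn_integral_mono_AE, eventually_elim)
    case (elim x)
    show ?case using elim epowr_le_affine[OF p l, of "\<rho> x"] p
      by (cases "x \<in> B") (auto simp: epowr_def)
  qed
  also have "\<dots> = ennreal (l powr p) * ennreal b + ennreal (l powr (p - 1)) * (\<integral>\<^sup>+x. \<rho> x * indicator B x \<partial>m)"
    by (simp add: nn_integral_add nn_integral_cmult B(3))
  also have "\<dots> \<le> ennreal (l powr p) * ennreal b + ennreal (l powr (p - 1)) * 1"
    using order_trans[OF \<rho>(2)[OF Bm] emeasure_le_1] by (intro add_left_mono mult_left_mono) auto
  also have "\<dots> = ennreal (l powr p * b + l powr (p - 1))"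
    using B(4) by (simp add: ennreal_mult)
  also have "l powr p * b + l powr (p - 1) = 2 * b powr (1 / N)"
  proof -
    have "l powr p * b = l powr (p - 1)"
      using B(4) by (simp add: l_def powr_diff)
    moreover have "l powr (p - 1) = b powr (1 / N)"
      using B(4) by (simp add: l_def p_def powr_divide powr_minus field_simps)
    ultimately show ?thesis by simp
  qed
  finally show ?thesis by (simp add: \<rho>_def p_def)
qed


lemma continuous_on_evaluation:
  "continuous_on S (\<lambda>\<gamma> :: 'b::topological_space \<Rightarrow>\<^sub>C 'a::metric_space. apply_bcontfun \<gamma> s)"
proof -
  have "1-lipschitz_on S (\<lambda>\<gamma> :: 'b \<Rightarrow>\<^sub>C 'a. apply_bcontfun \<gamma> s)"
    by (rule lipschitz_onI) (simp_all add: dist_bounded)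
  then show ?thesis by (rule lipschitz_on_continuous_on)
qed

lemma geodesic_in_ball:
  assumes \<gamma>: "\<gamma> \<in> geodesics" and s: "0 \<le> s" "s \<le> 1"
    and e: "dist x (apply_bcontfun \<gamma> 0) < a" "dist x (apply_bcontfun \<gamma> 1) < b"
  shows "dist x (apply_bcontfun \<gamma> s) < a + (a + b)"
proof -
  have "dist (apply_bcontfun \<gamma> 0) (apply_bcontfun \<gamma> s) = s * dist (apply_bcontfun \<gamma> 0) (apply_bcontfun \<gamma> 1)"
  proof -
    have "const_speed_geodesic dist (apply_bcontfun \<gamma>)" using \<gamma> by (simp add: geodesics_def)
    then have "dist (apply_bcontfun \<gamma> 0) (apply_bcontfun \<gamma> s) = \<bar>0 - s\<bar> * dist (apply_bcontfun \<gamma> 0) (apply_bcontfun \<gamma> 1)"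
      using s unfolding const_speed_geodesic_def by (meson atLeastAtMost_iff order_refl zero_le_one)
    then show ?thesis using s by simp
  qed
  also have "\<dots> \<le> dist (apply_bcontfun \<gamma> 0) (apply_bcontfun \<gamma> 1)"
    using s by (simp add: mult_left_le_one_le)
  also have "\<dots> < a + b"
    using e dist_triangle3[of "apply_bcontfun \<gamma> 0" "apply_bcontfun \<gamma> 1" x] by linarith
  finally show ?thesis
    using e dist_triangle[of x "apply_bcontfun \<gamma> s" "apply_bcontfun \<gamma> 0"] by linarith
qed

lemma dynamical_coupling_endpoints:
  fixes Q :: "(real \<Rightarrow>\<^sub>C 'a::polish_space) measure"
  assumes Q: "dynamical_optimal_coupling \<nu>0 \<nu>1 Q"
  shows "prob_space Q" "AE \<gamma> in Q. \<gamma> \<in> geodesics"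
    and "(AE y in \<nu>0. P y) \<Longrightarrow> AE \<gamma> in Q. P (apply_bcontfun \<gamma> 0)"
    and "(AE y in \<nu>1. P y) \<Longrightarrow> AE \<gamma> in Q. P (apply_bcontfun \<gamma> 1)"
proof -
  let ?e = "\<lambda>\<gamma> :: real \<Rightarrow>\<^sub>C 'a. (apply_bcontfun \<gamma> 0, apply_bcontfun \<gamma> 1)"
  have Q': "sets Q = sets (restrict_space borel geodesics)" "prob_space Q" "distr Q borel ?e \<in> couplings \<nu>0 \<nu>1"
    using Q by (auto simp: dynamical_optimal_coupling_def optimal_coupling_def)
  show "prob_space Q" by fact
  show "AE \<gamma> in Q. \<gamma> \<in> geodesics"
    using sets_eq_imp_space_eq[OF Q'(1)] by (intro AE_I2) (auto simp: space_restrict_space)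
  have meas: "f \<in> measurable Q borel" if "continuous_on UNIV f" for f :: "_ \<Rightarrow> 'b::topological_space"
    using measurable_restrict_space1[OF borel_measurable_continuous_onI[OF that], of geodesics]
      measurable_cong_sets[OF Q'(1) refl, of "borel :: 'b measure"] by simp
  have e: "?e \<in> measurable Q borel"
    by (intro meas continuous_on_Pair continuous_on_evaluation)
  have pr: "fst \<in> measurable (borel :: ('a \<times> 'a) measure) borel" "snd \<in> measurable (borel :: ('a \<times> 'a) measure) borel"
    by (auto intro!: borel_measurable_continuous_onI continuous_intros)
  have m0: "distr Q borel (\<lambda>\<gamma>. apply_bcontfun \<gamma> 0) = \<nu>0" and m1: "distr Q borel (\<lambda>\<gamma>. apply_bcontfun \<gamma> 1) = \<nu>1"
    using distr_distr[OF pr(1) e] distr_distr[OF pr(2) e] couplingsD(3,4)[OF Q'(3)] by (simp_all add: comp_def)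
  show "AE \<gamma> in Q. P (apply_bcontfun \<gamma> 0)" if "AE y in \<nu>0. P y"
    by (rule AE_distrD[where M' = borel, OF meas[OF continuous_on_evaluation]]) (unfold m0, rule that)
  show "AE \<gamma> in Q. P (apply_bcontfun \<gamma> 1)" if "AE y in \<nu>1. P y"
    by (rule AE_distrD[where M' = borel, OF meas[OF continuous_on_evaluation]]) (unfold m1, rule that)
qed

lemma tau_along_geodesic_lower_bound:
  assumes \<gamma>: "\<gamma> \<in> geodesics" and N: "1 < N" and t: "0 < t" "t < 1"
    and K: "0 \<le> K" "K / (N - 1) * (speed \<gamma>)\<^sup>2 \<le> 3"
    and k: "\<And>s. 0 \<le> s \<Longrightarrow> s \<le> 1 \<Longrightarrow> - K \<le> k (apply_bcontfun \<gamma> s)"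
  shows "ennreal (t / 2) \<le> tau (k_plus k \<gamma>) N t (speed \<gamma>)"
proof (rule tau_lower_bound[OF N _ t K])
  show "0 \<le> speed \<gamma>" by (simp add: speed_def)
  fix s assume "s \<in> {0..speed \<gamma>}"
  \<comment> \<open>For a constant geodesic the quotient is \<open>0\<close>, which lies in the unit interval as well.\<close>
  then have "0 \<le> s / speed \<gamma>" "s / speed \<gamma> \<le> 1" by (auto simp: divide_le_eq_1)
  then show "- K \<le> k_plus k \<gamma> s" unfolding k_plus_def unit_speed_param_def by (rule k)
qed

text \<open>All transport between \<open>ball x (t * R)\<close> and \<open>ball x0 R\<close> takes place inside \<open>ball x0 (5 * R)\<close>, so the
  distortion coefficients feel only the bound \<open>- K\<close> there. The curvature-dimension inequality for
  the two uniform measures, with its first summand bounded below by \<open>0\<close>, then compares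
  \<open>t / 2 * a powr (1 / N')\<close> with \<open>2 * b powr (1 / N')\<close>, where \<open>a\<close> and \<open>b\<close> are the measures of
  \<open>ball x0 R\<close> and of \<open>cball x (5 * t * R)\<close>.\<close>

lemma CD_volume_growth:
  fixes m :: "'a::polish_space measure"
  assumes mms: "metric_measure_space m" and supp: "measure_support m = UNIV"
    and CD: "CD m k N" and N': "N \<le> N'" "1 < N'" and R: "0 < R"
    and fin: "emeasure m (ball x0 (8 * R)) < \<infinity>"
    and K: "0 \<le> K" "K / (N' - 1) * (3 * R)\<^sup>2 \<le> 3"
    and k: "\<And>y. y \<in> ball x0 (8 * R) \<Longrightarrow> - K \<le> k y"
    and x: "x \<in> ball x0 R" and t: "0 < t" "t < 1"
  shows "ennreal ((t / 4) powr N' * measure m (ball x0 R)) \<le> emeasure m (cball x (5 * t * R))"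
proof -
  have m: "sets m = sets borel" using mms by (simp add: metric_measure_space_def)
  have \<sigma>: "sigma_finite_measure m" by (rule metric_measure_space_sigma_finite[OF mms])
  have pos: "0 < emeasure m (ball y r)" if "0 < r" for y r
  proof -
    have "y \<in> measure_support m" by (simp add: supp)
    then show ?thesis using that unfolding measure_support_def by auto
  qed
  have tR: "0 < t * R" "t * R < R" using t R by auto
  have sub_fin: "emeasure m A < \<infinity>" if "A \<subseteq> ball x0 (8 * R)" for A
    using le_less_trans[OF emeasure_mono[OF that] fin] m by simp
  define A0 A1 B where "A0 = ball x (t * R)" and "A1 = ball x0 R" and "B = cball x (5 * t * R)"
  have near: "dist x0 y < R + r" if "dist x y < r" for y r
    using that x dist_triangle[of x0 y x] by (simp add: dist_commute)
  have sub: "A0 \<subseteq> ball x0 (8 * R)" "A1 \<subseteq> ball x0 (8 * R)" "B \<subseteq> ball x0 (8 * R)"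
  proof -
    have "dist x0 y < R + R" if "y \<in> A0" for y
      using that tR by (intro near) (simp add: A0_def)
    then show "A0 \<subseteq> ball x0 (8 * R)" using R by force
    show "A1 \<subseteq> ball x0 (8 * R)" using R by (auto simp: A1_def)
    have "dist x0 y < R + 5 * R" if "y \<in> B" for y
      using that tR by (intro near) (simp add: B_def)
    then show "B \<subseteq> ball x0 (8 * R)" using R by force
  qed
  define \<nu>0 \<nu>1 where "\<nu>0 = uniform_measure m A0" and "\<nu>1 = uniform_measure m A1"
  have U0: "A0 \<in> sets borel" "A0 \<subseteq> cball x (t * R)" "0 < emeasure m A0" "emeasure m A0 < \<infinity>"
    and U1: "A1 \<in> sets borel" "A1 \<subseteq> cball x0 R" "0 < emeasure m A1" "emeasure m A1 < \<infinity>"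
    using pos tR R sub_fin sub by (auto simp: A0_def A1_def)
  have in_A0: "AE y in \<nu>0. y \<in> A0" and in_A1: "AE y in \<nu>1. y \<in> A1"
    unfolding \<nu>0_def \<nu>1_def using U0 U1 m by (auto intro!: AE_uniform_measureI)
  have P2: "\<nu>0 \<in> P2_ac m" "\<nu>1 \<in> P2_ac m"
    and bdd: "bounded (measure_support \<nu>0)" "bounded (measure_support \<nu>1)"
    using uniform_measure_P2_ac[OF m U0] uniform_measure_P2_ac[OF m U1]
      bounded_support_uniform_measure[OF m U0] bounded_support_uniform_measure[OF m U1]
    by (auto simp: \<nu>0_def \<nu>1_def)
  obtain Q \<nu> where Q: "dynamical_optimal_coupling \<nu>0 \<nu>1 Q"
    and \<nu>: "\<And>t. t \<in> {0..1} \<Longrightarrow> \<nu> t \<in> P2_ac m" "const_speed_geodesic W2 \<nu>" "\<nu> 0 = \<nu>0" "\<nu> 1 = \<nu>1"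
    and ent: "\<And>t N'. t \<in> {0..1} \<Longrightarrow> N \<le> N' \<Longrightarrow> entropy_S m N' (\<nu> t) \<le>
                - enn2ereal (\<integral>\<^sup>+\<gamma>.
                    (tau (k_minus k \<gamma>) N' (1 - t) (speed \<gamma>) *
                       epowr (RN_deriv m \<nu>0 (apply_bcontfun \<gamma> 0)) (- 1 / N')
                     + tau (k_plus k \<gamma>) N' t (speed \<gamma>) *
                       epowr (RN_deriv m \<nu>1 (apply_bcontfun \<gamma> 1)) (- 1 / N')) \<partial>Q)"
    using CD[unfolded CD_def, rule_format, OF P2 conjI, OF bdd] by blast
  have t01: "t \<in> {0..1}" using t by simp
  define a b where "a = measure m A1" and "b = measure m B"
  have a1: "emeasure m A1 = ennreal a"
    unfolding a_def using U1(4) by (intro emeasure_eq_ennreal_measure) simp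
  then have "0 < a" using U1(3) by simp
  note a = a1 this
  have "A0 \<subseteq> B" using tR by (auto simp: A0_def B_def)
  then have "emeasure m A0 \<le> emeasure m B"
    by (rule emeasure_mono) (simp add: m B_def)
  then have "0 < emeasure m B" using U0(3) by (rule order_less_le_trans[rotated])
  moreover have b1: "emeasure m B = ennreal b"
    unfolding b_def using sub_fin[OF sub(3)] by (intro emeasure_eq_ennreal_measure) simp
  ultimately have "0 < b" by simp
  note b = b1 this
  have P2': "\<nu>0 \<in> P2" "\<nu> t \<in> P2" "\<nu>1 \<in> P2"
    using P2 \<nu>(1)[OF t01] by (auto simp: P2_ac_def)
  have W: "W2 \<nu>0 (\<nu> t) = t * W2 \<nu>0 \<nu>1" "W2 (\<nu> t) \<nu>1 = (1 - t) * W2 \<nu>0 \<nu>1"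
  proof -
    have "W2 (\<nu> s) (\<nu> s') = \<bar>s - s'\<bar> * W2 \<nu>0 \<nu>1" if "s \<in> {0..1}" "s' \<in> {0..1}" for s s'
      using \<nu>(2) that unfolding const_speed_geodesic_def \<nu>(3,4) by blast
    from this[of 0 t] this[of t 1] show "W2 \<nu>0 (\<nu> t) = t * W2 \<nu>0 \<nu>1" "W2 (\<nu> t) \<nu>1 = (1 - t) * W2 \<nu>0 \<nu>1"
      using t by (simp_all add: \<nu>(3,4))
  qed
  have far0: "AE y in \<nu>0. dist x y \<le> t * R"
    using in_A0 by eventually_elim (simp add: A0_def)
  have far1: "AE w in \<nu>1. dist x w \<le> 2 * R"
    using in_A1
  proof eventually_elim
    case (elim w)
    then show ?case using x dist_triangle3[of x w x0] by (simp add: A1_def)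
  qed
  have "AE z in \<nu> t. dist x z \<le> t * R + t * (t * R + 2 * R) + t * R"
    using tR R by (intro wasserstein_intermediate_concentrated[OF P2' t W far0 far1]) auto
  moreover have "t * R + t * (t * R + 2 * R) + t * R \<le> 5 * t * R"
    using mult_left_mono[of "t * R" R t] t tR by (simp add: algebra_simps)
  ultimately have in_B: "AE z in \<nu> t. z \<in> B"
    unfolding B_def mem_cball by (elim eventually_mono) (rule order_trans)
  define X where "X = (\<integral>\<^sup>+z. epowr (ac_density m (\<nu> t) z) (1 - 1 / N') \<partial>m)"
  have t2: "0 \<le> t / 2" using t by simp
  define Y where "Y = ennreal (t / 2 * a powr (1 / N'))"
  have X: "X \<le> ennreal (2 * b powr (1 / N'))"
    unfolding X_def by (rule entropy_integral_bound[OF \<sigma> m \<nu>(1)[OF t01] _ in_B b N'(2)]) (simp add: B_def)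
  note Qe = dynamical_coupling_endpoints[OF Q]
  interpret Q: prob_space Q by (rule Qe)
  have "AE \<gamma> in Q. Y \<le> tau (k_minus k \<gamma>) N' (1 - t) (speed \<gamma>) *
                       epowr (RN_deriv m \<nu>0 (apply_bcontfun \<gamma> 0)) (- 1 / N')
                     + tau (k_plus k \<gamma>) N' t (speed \<gamma>) *
                       epowr (RN_deriv m \<nu>1 (apply_bcontfun \<gamma> 1)) (- 1 / N')"
    using Qe(2) Qe(3)[OF in_A0] Qe(4)[OF in_A1] Qe(4)[OF RN_deriv_uniform_measure[OF m U1, folded \<nu>1_def]]
  proof eventually_elim
    case (elim \<gamma>)
    have e0: "dist x0 (apply_bcontfun \<gamma> 0) < 2 * R"
      using near[of "apply_bcontfun \<gamma> 0" "t * R"] elim(2) tR by (simp add: A0_def)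
    have e1: "dist x0 (apply_bcontfun \<gamma> 1) < R" using elim(3) by (simp add: A1_def)
    have "speed \<gamma> \<le> 3 * R"
      using dist_triangle3[of "apply_bcontfun \<gamma> 0" "apply_bcontfun \<gamma> 1" x0] e0 e1 by (simp add: speed_def)
    then have "(speed \<gamma>)\<^sup>2 \<le> (3 * R)\<^sup>2" by (intro power_mono) (simp_all add: speed_def)
    then have "K / (N' - 1) * (speed \<gamma>)\<^sup>2 \<le> K / (N' - 1) * (3 * R)\<^sup>2"
      using K N' by (intro mult_left_mono) auto
    then have K': "K / (N' - 1) * (speed \<gamma>)\<^sup>2 \<le> 3" using K(2) by simp
    have \<tau>: "ennreal (t / 2) \<le> tau (k_plus k \<gamma>) N' t (speed \<gamma>)"
    proof (rule tau_along_geodesic_lower_bound[OF elim(1) N'(2) t K(1) K'])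
      fix s :: real assume "0 \<le> s" "s \<le> 1"
      then have "dist x0 (apply_bcontfun \<gamma> s) < 2 * R + (2 * R + R)"
        by (rule geodesic_in_ball[OF elim(1) _ _ e0 e1])
      then show "- K \<le> k (apply_bcontfun \<gamma> s)" using R by (intro k) simp
    qed
    have "RN_deriv m \<nu>1 (apply_bcontfun \<gamma> 1) = ennreal (1 / a)"
      using elim(4) a divide_ennreal[of 1 a] by simp
    then have "epowr (RN_deriv m \<nu>1 (apply_bcontfun \<gamma> 1)) (- 1 / N') = ennreal (a powr (1 / N'))"
      using a by (simp add: epowr_def powr_divide powr_minus field_simps)
    then have "Y \<le> tau (k_plus k \<gamma>) N' t (speed \<gamma>) * epowr (RN_deriv m \<nu>1 (apply_bcontfun \<gamma> 1)) (- 1 / N')"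
      unfolding Y_def ennreal_mult'[OF t2] using mult_right_mono[OF \<tau>] by simp
    then show ?case by (rule order_trans) simp
  qed
  then have "(\<integral>\<^sup>+\<gamma>. Y \<partial>Q) \<le> (\<integral>\<^sup>+\<gamma>.
                    (tau (k_minus k \<gamma>) N' (1 - t) (speed \<gamma>) *
                       epowr (RN_deriv m \<nu>0 (apply_bcontfun \<gamma> 0)) (- 1 / N')
                     + tau (k_plus k \<gamma>) N' t (speed \<gamma>) *
                       epowr (RN_deriv m \<nu>1 (apply_bcontfun \<gamma> 1)) (- 1 / N')) \<partial>Q)"
    by (rule nn_integral_mono_AE)
  also have "\<dots> \<le> X"
    using ent[OF t01 N'(1)] by (simp add: entropy_S_def X_def less_eq_ennreal.rep_eq)
  also note X
  finally have "Y \<le> ennreal (2 * b powr (1 / N'))" by (simp add: Q.emeasure_space_1)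
  then have "t / 2 * a powr (1 / N') \<le> 2 * b powr (1 / N')" by (simp add: Y_def)
  then have "t / 4 * a powr (1 / N') \<le> b powr (1 / N')" by simp
  then have "(t / 4 * a powr (1 / N')) powr N' \<le> (b powr (1 / N')) powr N'"
    using t N' by (intro powr_mono2) auto
  moreover have "(t / 4 * a powr (1 / N')) powr N' = (t / 4) powr N' * a"
    using N' a by (subst powr_mult) (simp_all add: powr_powr)
  moreover have "(b powr (1 / N')) powr N' = b" using N' b by (simp add: powr_powr)
  ultimately have "(t / 4) powr N' * a \<le> b" by simp
  then have "ennreal ((t / 4) powr N' * a) \<le> ennreal b" by (rule ennreal_leI)
  then show ?thesis using b(1) by (simp add: a_def A1_def B_def)
qed

section \<open>The dimension bound\<close>

text \<open>Local boundedness of \<open>k\<close> from below and local finiteness of \<open>m\<close> let the volume growth bound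
  apply on a ball around every point, with a radius and a constant that depend on the point and on
  the exponent.\<close>

lemma CD_locally_null:
  fixes m :: "'a::polish_space measure" and x0 :: 'a
  assumes mms: "metric_measure_space m" and supp: "measure_support m = UNIV"
    and k: "locally_bounded_below k" and CD: "CD m k N" and N': "N \<le> N'" "1 < N'" "N' < s"
  shows "\<exists>U. open U \<and> x0 \<in> U \<and> (\<forall>\<delta>>0. hausdorff_pre s \<delta> U = 0)"
proof -
  have m: "sets m = sets borel" using mms by (simp add: metric_measure_space_def)
  obtain r1 where r1: "0 < r1" "emeasure m (ball x0 r1) < \<infinity>"
    using mms by (auto simp: metric_measure_space_def)
  obtain V c where V: "open V" "x0 \<in> V" "\<And>y. y \<in> V \<Longrightarrow> c \<le> k y"
    using spec[OF k[unfolded locally_bounded_below_def], of x0] by blast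
  obtain r2 where r2: "0 < r2" "ball x0 r2 \<subseteq> V" using openE[OF V(1,2)] by blast
  define K where "K = max 0 (- c)"
  \<comment> \<open>The bound \<open>R\<^sup>2 \<le> q\<close> yields \<open>K / (N' - 1) * (3 * R)\<^sup>2 \<le> 3\<close>, where \<open>3 * R\<close> bounds the length of the
    geodesics.\<close>
  define q where "q = (N' - 1) / (3 * (K + 1))"
  define R where "R = min (min r1 r2 / 8) (sqrt q)"
  have K: "0 \<le> K" "- K \<le> c" by (auto simp: K_def)
  have q: "0 < q" using N' K by (simp add: q_def)
  have R: "0 < R" "8 * R \<le> r1" "8 * R \<le> r2" "R \<le> sqrt q"
    using r1 r2 q by (auto simp: R_def)
  have "R\<^sup>2 \<le> q" using R q power_mono[of R "sqrt q" 2] by simp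
  then have "K / (N' - 1) * (3 * R)\<^sup>2 \<le> K / (N' - 1) * (9 * q)"
    using K N' by (intro mult_left_mono) (auto simp: power_mult_distrib)
  also have "\<dots> = 3 * K / (K + 1)" using N' K by (simp add: q_def divide_simps) (simp add: algebra_simps)
  also have "\<dots> \<le> 3" using K by (simp add: divide_simps)
  finally have KR: "K / (N' - 1) * (3 * R)\<^sup>2 \<le> 3" .
  have fin: "emeasure m (ball x0 (8 * R)) < \<infinity>"
    by (rule le_less_trans[OF emeasure_mono r1(2)]) (use R(2) m in auto)
  have kK: "- K \<le> k y" if "y \<in> ball x0 (8 * R)" for y
  proof -
    have "y \<in> V" using that R(3) r2(2) by auto
    then show ?thesis using V(3)[of y] K by simp
  qed
  note growth = CD_volume_growth[OF mms supp CD N'(1,2) R(1) fin K(1) KR kK]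
  have "x0 \<in> measure_support m" by (simp add: supp)
  then have "0 < emeasure m (ball x0 R)" using R(1) unfolding measure_support_def by auto
  moreover have "emeasure m (ball x0 R) \<le> emeasure m (ball x0 (8 * R))"
    using R(1) m by (intro emeasure_mono) auto
  then have "emeasure m (ball x0 R) \<noteq> \<top>" using fin by (auto simp: top_unique)
  ultimately have a: "0 < measure m (ball x0 R)"
    by (simp add: emeasure_eq_ennreal_measure)
  have null: "hausdorff_pre s \<delta> (ball x0 R) = 0" if \<delta>: "0 < \<delta>" for \<delta>
  proof (rule hausdorff_pre_null_of_volume_growth[where m = m and p = N' and r_max = "5 * R"
        and c = "measure m (ball x0 R) / (20 * R) powr N'" and B = "ball x0 (8 * R)"])
    fix x r assume x: "x \<in> ball x0 R" and r: "0 < r" "r < 5 * R"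
    \<comment> \<open>A radius \<open>r\<close> corresponds to the time \<open>t = r / (5 * R)\<close>.\<close>
    have "ennreal ((r / (5 * R) / 4) powr N' * measure m (ball x0 R)) \<le> emeasure m (cball x (5 * (r / (5 * R)) * R))"
      using r R(1) by (intro growth x) auto
    moreover have "(r / (5 * R) / 4) powr N' = r powr N' / (20 * R) powr N'"
      using r R(1) by (simp add: powr_divide[symmetric])
    moreover have "5 * (r / (5 * R)) * R = r" using R(1) by simp
    ultimately show "ennreal (measure m (ball x0 R) / (20 * R) powr N' * r powr N') \<le> emeasure m (cball x r)"
      by (simp add: mult.commute)
  next
    fix x r assume x: "x \<in> ball x0 R" and r: "r < 5 * R"
    show "cball x r \<subseteq> ball x0 (8 * R)"
    proof
      fix y assume "y \<in> cball x r"
      then show "y \<in> ball x0 (8 * R)"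
        using x r R(1) dist_triangle[of x0 y x] by (simp add: dist_commute)
    qed
  next
    show "0 < measure m (ball x0 R) / (20 * R) powr N'" using a R(1) by simp
  qed (use m fin \<delta> N' R(1) in simp_all)
  show ?thesis using R(1) null by (intro exI[of _ "ball x0 R"]) auto
qed

theorem corollary5p5:
  fixes m :: "'a::polish_space measure" and k :: "'a \<Rightarrow> real" and N :: real
  assumes "metric_measure_space m"
    and "measure_support m = UNIV"
    and "admissible k"
    and "N \<ge> 1"
    and "CD m k N"
  shows "hausdorff_dim (UNIV :: 'a set) \<le> ereal N"
proof (rule ereal_le_epsilon2)
  fix e :: real assume e: "0 < e"
  have "hausdorff_measure (N + e) (UNIV :: 'a set) = 0"
  proof (rule hausdorff_measure_UNIV_null)
    fix x :: 'a
    show "\<exists>U. open U \<and> x \<in> U \<and> (\<forall>\<delta>>0. hausdorff_pre (N + e) \<delta> U = 0)"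
      using assms e by (intro CD_locally_null[where m = m and k = k and N = N and N' = "N + e / 2"])
        (auto simp: admissible_def)
  qed
  then have "hausdorff_dim (UNIV :: 'a set) \<le> ereal (N + e)"
    unfolding hausdorff_dim_def using assms(4) e by (intro Inf_lower) auto
  then show "hausdorff_dim (UNIV :: 'a set) \<le> ereal N + ereal e" by simp
qed

end
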